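(* Let $I$ be an instance of the Course Allocation problem with both prerequisites and corequisites (CACPR) in which applicants have lexicographic preferences, and let $\sigma$ be a policy for $I$. Then algorithm SM-CACPR run on $I$ and $\sigma$ outputs a Pareto optimal matching of $I$, and it runs in time $O(N+n_2(L+\Delta))$, where $N$ is the sum of the applicants' capacities, $n_2$ is the number of courses, $L$ is the total length of the applicants' preference lists and $\Delta$ is the total number of immediate prerequisites, taken over all applicants.
   Context: An instance of CACPR consists of a set of applicants $A$, a set of courses $C$ (with $n_2=|C|$), a positive integer capacity $q(x)$ for every applicant and course $x$, for each applicant $a_i$ a strict linear order $P(a_i)$ over a subset of $C$ (the acceptable courses of $a_i$), an equivalence relation $\leftrightarrow$ on $C$ common to all applicants, whose classes $C^1,\dots,C^r$ are called supercourses, and for each applicant $a_i$ a strict partial order $\to_{a_i}$ on the set of supercourses (her prerequisites), given by its immediate prerequisites ($C^k$ is an immediate prerequisite of $C^j$ if $C^j\to_{a_i}C^k$ and no $C^l$ satisfies $C^j\to_{a_i}C^l\to_{a_i}C^k$); it is assumed that if all courses of $C^j$ are acceptable to $a_i$ and $C^j\to_{a_i}C^k$ then all courses of $C^k$ are acceptable to $a_i$. A bundle $C'\subseteq C$ is feasible for $a_i$ if its courses are acceptable to $a_i$, $|C'|\le q(a_i)$, $C'$ is a union of supercourses, and whenever $C^j\subseteq C'$ and $C^j\to_{a_i}C^k$ then $C^k\subseteq C'$. A matching is a set $M\subseteq A\times C$ such that each $M(a_i)=\{c:(a_i,c)\in M\}$ is feasible for $a_i$ and each course $c_j$ is assigned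 to at most $q(c_j)$ applicants (full if exactly $q(c_j)$, undersubscribed otherwise). Lexicographic preferences: $a_i$ prefers bundle $C_1$ to bundle $C_2\neq C_1$ iff the course of $C_1\oplus C_2$ ranked highest in $P(a_i)$ belongs to $C_1$. $M'$ dominates $M$ if some applicant prefers $M'(a_i)$ to $M(a_i)$ and no applicant prefers $M(a_i)$ to $M'(a_i)$; $M$ is Pareto optimal if no matching dominates it. A policy is a sequence of applicants in which each applicant $a_i$ appears at most $q(a_i)$ times. Algorithm SM-CACPR: each applicant $a_i$'s supercourse list consists of the supercourses all of whose courses are acceptable to her, ordered by the position in $P(a_i)$ of their most-preferred course; for a supercourse $C^j$ let $D_{a_i}(C^j)$ be the set consisting of $C^j$ and all $C^k$ with $C^j\to_{a_i}C^k$. Start with no supercourse assigned to anyone; each applicant has a pointer to the start of her supercourse list. Process the entries of $\sigma$ in order; on the turn of $a_i$, repeat until either $a_i$ receives supercourses in this turn or her pointer has passed the end of her list: let $C^j$ be the supercourse at her pointer and advance the pointer; if $C^j$ is not yet assigned to $a_i$ and every course in $C^j$ is undersubscribed, let $S$ be the set of supercourses in $D_{a_i}(C^j)$ not yet assigned to $a_i$; if no course belonging to a supercourse in $S$ is full, and the total number of courses in supercourses already assigned to $a_i$ plus the total number of courses in supercourses of $S$ is at most $q(a_i)$, assign every supercourse in $S$ to $a_i$ (ending the turn). Finally output $M=\{(a_i,c): c\in C^k, C^k \text{ assigned to } a_i\}$.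
   Formalization: Pareto optimality is stated only for policies in which each applicant appears exactly q(a_i) times or at least as often as her supercourse list has entries; for a policy with fewer turns (e.g. the empty one) the claim fails. The output is a matching and the time bound holds for every policy. *)

theory Defs
  imports Main "HOL-Library.Monad_Syntax"
begin

text \<open>
  A preference list is a duplicate-free list of courses, most preferred first; the courses
  on it are the acceptable ones.  The supercourses are the classes of \<open>coreq\<close>, as sets of
  courses.  \<open>(X, Y) \<in> prereq I a\<close> means that supercourse \<open>Y\<close> is a prerequisite of
  supercourse \<open>X\<close> for applicant \<open>a\<close>.
\<close>

record ('a, 'c) cacpr =
  applicants :: "'a set"
  courses :: "'c set"
  acap :: "'a \<Rightarrow> nat"
  ccap :: "'c \<Rightarrow> nat"
  pref :: "'a \<Rightarrow> 'c list"
  coreq :: "('c \<times> 'c) set"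
  prereq :: "'a \<Rightarrow> ('c set \<times> 'c set) set"

definition supercourses :: "('a, 'c) cacpr \<Rightarrow> 'c set set" where
  "supercourses I = courses I // coreq I"

definition acceptable :: "('a, 'c) cacpr \<Rightarrow> 'a \<Rightarrow> 'c set" where
  "acceptable I a = set (pref I a)"

definition immediate_prereq :: "('a, 'c) cacpr \<Rightarrow> 'a \<Rightarrow> ('c set \<times> 'c set) set" where
  "immediate_prereq I a =
     {(X, Y). (X, Y) \<in> prereq I a \<and> \<not> (\<exists>Z. (X, Z) \<in> prereq I a \<and> (Z, Y) \<in> prereq I a)}"

definition cacpr_instance :: "('a, 'c) cacpr \<Rightarrow> bool" where
  "cacpr_instance I \<longleftrightarrow>
     finite (applicants I) \<and> finite (courses I) \<and>
     (\<forall>a\<in>applicants I. 0 < acap I a) \<and> (\<forall>c\<in>courses I. 0 < ccap I c) \<and>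
     (\<forall>a\<in>applicants I. distinct (pref I a) \<and> acceptable I a \<subseteq> courses I) \<and>
     equiv (courses I) (coreq I) \<and>
     (\<forall>a\<in>applicants I.
        prereq I a \<subseteq> supercourses I \<times> supercourses I \<and> irrefl (prereq I a) \<and> trans (prereq I a) \<and>
        (\<forall>(X, Y)\<in>prereq I a. X \<subseteq> acceptable I a \<longrightarrow> Y \<subseteq> acceptable I a))"

definition feasible :: "('a, 'c) cacpr \<Rightarrow> 'a \<Rightarrow> 'c set \<Rightarrow> bool" where
  "feasible I a B \<longleftrightarrow>
     B \<subseteq> acceptable I a \<and> card B \<le> acap I a \<and> (\<exists>F \<subseteq> supercourses I. B = \<Union>F) \<and>
     (\<forall>(X, Y)\<in>prereq I a. X \<subseteq> B \<longrightarrow> Y \<subseteq> B)"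

definition bundle_of :: "('a \<times> 'c) set \<Rightarrow> 'a \<Rightarrow> 'c set" where
  "bundle_of M a = {c. (a, c) \<in> M}"

definition matching :: "('a, 'c) cacpr \<Rightarrow> ('a \<times> 'c) set \<Rightarrow> bool" where
  "matching I M \<longleftrightarrow>
     M \<subseteq> applicants I \<times> courses I \<and>
     (\<forall>a\<in>applicants I. feasible I a (bundle_of M a)) \<and>
     (\<forall>c\<in>courses I. card {a. (a, c) \<in> M} \<le> ccap I c)"

definition ranked_above :: "('a, 'c) cacpr \<Rightarrow> 'a \<Rightarrow> 'c \<Rightarrow> 'c \<Rightarrow> bool" where
  "ranked_above I a c d \<longleftrightarrow>
     (\<exists>i j. i < j \<and> j < length (pref I a) \<and> pref I a ! i = c \<and> pref I a ! j = d)"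

definition prefers :: "('a, 'c) cacpr \<Rightarrow> 'a \<Rightarrow> 'c set \<Rightarrow> 'c set \<Rightarrow> bool" where
  "prefers I a B1 B2 \<longleftrightarrow>
     (let D = (B1 - B2) \<union> (B2 - B1)
      in \<exists>c\<in>D. (\<forall>d\<in>D. d \<noteq> c \<longrightarrow> ranked_above I a c d) \<and> c \<in> B1)"

definition dominates :: "('a, 'c) cacpr \<Rightarrow> ('a \<times> 'c) set \<Rightarrow> ('a \<times> 'c) set \<Rightarrow> bool" where
  "dominates I M' M \<longleftrightarrow>
     (\<exists>a\<in>applicants I. prefers I a (bundle_of M' a) (bundle_of M a)) \<and>
     \<not> (\<exists>a\<in>applicants I. prefers I a (bundle_of M a) (bundle_of M' a))"

definition pareto_optimal :: "('a, 'c) cacpr \<Rightarrow> ('a \<times> 'c) set \<Rightarrow> bool" where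
  "pareto_optimal I M \<longleftrightarrow> matching I M \<and> \<not> (\<exists>M'. matching I M' \<and> dominates I M' M)"

definition supercourse_position :: "('a, 'c) cacpr \<Rightarrow> 'a \<Rightarrow> 'c set \<Rightarrow> nat" where
  "supercourse_position I a X = (LEAST i. i < length (pref I a) \<and> pref I a ! i \<in> X)"

definition supercourse_list :: "('a, 'c) cacpr \<Rightarrow> 'a \<Rightarrow> 'c set list" where
  "supercourse_list I a =
     sorted_key_list_of_set (supercourse_position I a) {X \<in> supercourses I. X \<subseteq> acceptable I a}"

definition policy :: "('a, 'c) cacpr \<Rightarrow> 'a list \<Rightarrow> bool" where
  "policy I \<sigma> \<longleftrightarrow> set \<sigma> \<subseteq> applicants I \<and> (\<forall>a\<in>applicants I. count_list \<sigma> a \<le> acap I a)"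

text \<open>
  A policy may stop too early: the empty sequence is a policy, and it produces the empty
  matching.  Pareto optimality is therefore a property of policies which give every applicant
  all the turns she can make use of.  This holds if each applicant occurs exactly
  \<open>acap I a\<close> times; one turn for each entry of her supercourse list is enough as well.
\<close>

definition complete_policy :: "('a, 'c) cacpr \<Rightarrow> 'a list \<Rightarrow> bool" where
  "complete_policy I \<sigma> \<longleftrightarrow> policy I \<sigma> \<and>
     (\<forall>a\<in>applicants I. count_list \<sigma> a = acap I a \<or>
        length (supercourse_list I a) \<le> count_list \<sigma> a)"

definition with_prereqs :: "('a, 'c) cacpr \<Rightarrow> 'a \<Rightarrow> 'c set \<Rightarrow> 'c set set" where
  "with_prereqs I a X = insert X {Y. (X, Y) \<in> prereq I a}"

definition occupancy :: "('a, 'c) cacpr \<Rightarrow> ('a \<Rightarrow> 'c set set) \<Rightarrow> 'c \<Rightarrow> nat" where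
  "occupancy I asg c = card {a \<in> applicants I. c \<in> \<Union>(asg a)}"

definition full :: "('a, 'c) cacpr \<Rightarrow> ('a \<Rightarrow> 'c set set) \<Rightarrow> 'c \<Rightarrow> bool" where
  "full I asg c \<longleftrightarrow> occupancy I asg c = ccap I c"

definition undersubscribed :: "('a, 'c) cacpr \<Rightarrow> ('a \<Rightarrow> 'c set set) \<Rightarrow> 'c \<Rightarrow> bool" where
  "undersubscribed I asg c \<longleftrightarrow> occupancy I asg c < ccap I c"

text \<open>
  \<open>asg a\<close> is the set of supercourses assigned to \<open>a\<close>.  The pointer of an applicant is
  represented by the part of her supercourse list that begins at the pointer.
\<close>

fun turn :: "('a, 'c) cacpr \<Rightarrow> 'a \<Rightarrow> 'c set list \<Rightarrow> ('a \<Rightarrow> 'c set set)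
    \<Rightarrow> 'c set list \<times> ('a \<Rightarrow> 'c set set)" where
  "turn I a [] asg = ([], asg)"
| "turn I a (X # Xs) asg =
     (let S = with_prereqs I a X - asg a in
      if X \<notin> asg a \<and> (\<forall>c\<in>X. undersubscribed I asg c) \<and> (\<forall>c\<in>\<Union>S. \<not> full I asg c) \<and>
         (\<Sum>Y\<in>asg a. card Y) + (\<Sum>Y\<in>S. card Y) \<le> acap I a
      then (Xs, asg(a := asg a \<union> S))
      else turn I a Xs asg)"

fun process :: "('a, 'c) cacpr \<Rightarrow> 'a list \<Rightarrow> ('a \<Rightarrow> 'c set list) \<Rightarrow> ('a \<Rightarrow> 'c set set)
    \<Rightarrow> ('a \<Rightarrow> 'c set set)" where
  "process I [] ptr asg = asg"
| "process I (a # \<sigma>) ptr asg =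
     (let (Xs, asg') = turn I a (ptr a) asg in process I \<sigma> (ptr(a := Xs)) asg')"

definition sm_cacpr :: "('a, 'c) cacpr \<Rightarrow> 'a list \<Rightarrow> ('a \<times> 'c) set" where
  "sm_cacpr I \<sigma> =
     (let asg = process I \<sigma> (supercourse_list I) (\<lambda>_. {})
      in {(a, c). a \<in> applicants I \<and> c \<in> \<Union>(asg a)})"

text \<open>
  Step-counting monad.  Every evaluation of a defining equation below costs one step, marked by
  \<open>tick\<close>; apart from calls of functions which are charged themselves, an equation performs a
  bounded number of elementary operations: list construction and destruction, arithmetic and
  comparison of numbers, comparison of identifiers, and reads and single writes of array cells.
  Arrays are functions from indices, and \<open>f(i := v)\<close> is a write.  As usual for random
  access machines, memory is initially blank (zero, false, empty).
\<close>

datatype 'x tm = TM (val: 'x) (steps: nat)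

definition bind_tm :: "'x tm \<Rightarrow> ('x \<Rightarrow> 'y tm) \<Rightarrow> 'y tm" where
  "bind_tm m f = TM (val (f (val m))) (steps m + steps (f (val m)))"

adhoc_overloading Monad_Syntax.bind \<rightleftharpoons> bind_tm

definition return_tm :: "'x \<Rightarrow> 'x tm" where
  "return_tm x = TM x 0"

definition tick :: "'x tm \<Rightarrow> 'x tm" where
  "tick m = TM (val m) (Suc (steps m))"

lemma bind_tm_cong [fundef_cong]:
  "m = m' \<Longrightarrow> (\<And>x. x = val m' \<Longrightarrow> f x = f' x) \<Longrightarrow> bind_tm m f = bind_tm m' f'"
  by (simp add: bind_tm_def)

text \<open>
  The input as it is stored: supercourses are numbered \<open>0, ..., in_count - 1\<close>, with the number
  of the supercourse of each course and the members of each supercourse; the prerequisites of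
  each applicant are given by adjacency lists of immediate prerequisites.
\<close>

record ('a, 'c) input =
  in_applicants :: "'a list"
  in_acap :: "'a \<Rightarrow> nat"
  in_ccap :: "'c \<Rightarrow> nat"
  in_pref :: "'a \<Rightarrow> 'c list"
  in_count :: nat
  in_class :: "'c \<Rightarrow> nat"
  in_members :: "nat \<Rightarrow> 'c list"
  in_imm :: "'a \<Rightarrow> nat \<Rightarrow> nat list"

definition encodes :: "('a, 'c) input \<Rightarrow> ('a, 'c) cacpr \<Rightarrow> bool" where
  "encodes E I \<longleftrightarrow>
     distinct (in_applicants E) \<and> set (in_applicants E) = applicants I \<and>
     (\<forall>a\<in>applicants I. in_acap E a = acap I a \<and> in_pref E a = pref I a) \<and>
     (\<forall>c\<in>courses I. in_ccap E c = ccap I c) \<and>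
     bij_betw (\<lambda>k. set (in_members E k)) {..<in_count E} (supercourses I) \<and>
     (\<forall>k<in_count E. distinct (in_members E k) \<and> (\<forall>c\<in>set (in_members E k). in_class E c = k)) \<and>
     (\<forall>a\<in>applicants I. \<forall>k<in_count E.
        distinct (in_imm E a k) \<and> set (in_imm E a k) \<subseteq> {..<in_count E} \<and>
        (\<lambda>l. set (in_members E l)) ` set (in_imm E a k) =
          {Y. (set (in_members E k), Y) \<in> immediate_prereq I a})"

text \<open>
  \<open>acc c = Some a\<close> marks \<open>c\<close> as acceptable to \<open>a\<close>, and \<open>seen k = Some a\<close> marks
  supercourse \<open>k\<close> as already met on the preference list of \<open>a\<close>; since each mark names the
  applicant, the two arrays need not be cleared between applicants.
\<close>

fun mark_acceptable :: "'a \<Rightarrow> 'c list \<Rightarrow> ('c \<Rightarrow> 'a option) \<Rightarrow> ('c \<Rightarrow> 'a option) tm" where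
  "mark_acceptable a [] acc = tick (return_tm acc)"
| "mark_acceptable a (c # cs) acc = tick (mark_acceptable a cs (acc(c := Some a)))"

fun all_marked :: "'a \<Rightarrow> ('c \<Rightarrow> 'a option) \<Rightarrow> 'c list \<Rightarrow> bool tm" where
  "all_marked a acc [] = tick (return_tm True)"
| "all_marked a acc (c # cs) =
     tick (if acc c = Some a then all_marked a acc cs else return_tm False)"

fun build_list :: "('a, 'c) input \<Rightarrow> 'a \<Rightarrow> ('c \<Rightarrow> 'a option) \<Rightarrow> 'c list \<Rightarrow> (nat \<Rightarrow> 'a option)
    \<Rightarrow> (nat list \<times> (nat \<Rightarrow> 'a option)) tm" where
  "build_list E a acc [] seen = tick (return_tm ([], seen))"
| "build_list E a acc (c # cs) seen = tick (
     let k = in_class E c in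
     if seen k = Some a then build_list E a acc cs seen
     else do {
       ok \<leftarrow> all_marked a acc (in_members E k);
       (ks, seen') \<leftarrow> build_list E a acc cs (seen(k := Some a));
       return_tm (if ok then k # ks else ks, seen')
     })"

fun build_lists :: "('a, 'c) input \<Rightarrow> 'a list \<Rightarrow> ('c \<Rightarrow> 'a option) \<Rightarrow> (nat \<Rightarrow> 'a option)
    \<Rightarrow> ('a \<Rightarrow> nat list) \<Rightarrow> ('a \<Rightarrow> nat list) tm" where
  "build_lists E [] acc seen ptr = tick (return_tm ptr)"
| "build_lists E (a # as) acc seen ptr = tick (do {
     acc' \<leftarrow> mark_acceptable a (in_pref E a) acc;
     (ks, seen') \<leftarrow> build_list E a acc' (in_pref E a) seen;
     build_lists E as acc' seen' (ptr(a := ks))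
   })"

fun push_all :: "nat list \<Rightarrow> nat list \<Rightarrow> nat list tm" where
  "push_all [] stk = tick (return_tm stk)"
| "push_all (k # ks) stk = tick (push_all ks (k # stk))"

text \<open>
  Graph search along the immediate prerequisites \<open>adj\<close>, with a stack; collects in \<open>out\<close> the
  supercourses it reaches.  \<open>vis k = st\<close> marks \<open>k\<close> as visited by the current search; each
  search uses a new stamp \<open>st\<close>, so the array need not be cleared.  The test \<open>k < r\<close> always
  succeeds on encodings of instances; it makes the function total.
\<close>

function search :: "nat \<Rightarrow> (nat \<Rightarrow> nat list) \<Rightarrow> nat \<Rightarrow> nat list \<Rightarrow> (nat \<Rightarrow> nat) \<Rightarrow> nat list
    \<Rightarrow> (nat list \<times> (nat \<Rightarrow> nat)) tm" where
  "search r adj st [] vis out = tick (return_tm (out, vis))"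
| "search r adj st (k # stk) vis out = tick (
     if k < r \<and> vis k \<noteq> st then do {
       stk' \<leftarrow> push_all (adj k) stk;
       search r adj st stk' (vis(k := st)) (k # out)
     }
     else search r adj st stk vis out)"
  by pat_completeness auto

termination
proof (relation "measures [\<lambda>(r, adj, st, stk, vis, out). card {k. k < r \<and> vis k \<noteq> st},
    \<lambda>(r, adj, st, stk, vis, out). length stk]", goal_cases)
  case (2 r adj st k stk vis out stk')
  then have "{l. l < r \<and> (vis(k := st)) l \<noteq> st} \<subset> {l. l < r \<and> vis l \<noteq> st}"
    by auto
  then have "card {l. l < r \<and> (vis(k := st)) l \<noteq> st} < card {l. l < r \<and> vis l \<noteq> st}"
    by (intro psubset_card_mono) auto
  then show ?case by simp
qed auto

text \<open>\<open>has (a, k)\<close> tells whether supercourse \<open>k\<close> is assigned to \<open>a\<close>.\<close>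

fun unassigned :: "('a \<times> nat \<Rightarrow> bool) \<Rightarrow> 'a \<Rightarrow> nat list \<Rightarrow> nat list tm" where
  "unassigned has a [] = tick (return_tm [])"
| "unassigned has a (k # ks) = tick (do {
     ls \<leftarrow> unassigned has a ks;
     return_tm (if has (a, k) then ls else k # ls)
   })"

text \<open>\<open>cnt c\<close> is the number of applicants to whom course \<open>c\<close> is assigned.\<close>

fun room_in :: "('a, 'c) input \<Rightarrow> ('c \<Rightarrow> nat) \<Rightarrow> 'c list \<Rightarrow> bool tm" where
  "room_in E cnt [] = tick (return_tm True)"
| "room_in E cnt (c # cs) =
     tick (if cnt c < in_ccap E c then room_in E cnt cs else return_tm False)"

fun room_in_all :: "('a, 'c) input \<Rightarrow> ('c \<Rightarrow> nat) \<Rightarrow> nat list \<Rightarrow> bool tm" where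
  "room_in_all E cnt [] = tick (return_tm True)"
| "room_in_all E cnt (k # ks) = tick (do {
     ok \<leftarrow> room_in E cnt (in_members E k);
     if ok then room_in_all E cnt ks else return_tm False
   })"

fun count_courses :: "'c list \<Rightarrow> nat \<Rightarrow> nat tm" where
  "count_courses [] n = tick (return_tm n)"
| "count_courses (c # cs) n = tick (count_courses cs (Suc n))"

fun count_all_courses :: "('a, 'c) input \<Rightarrow> nat list \<Rightarrow> nat \<Rightarrow> nat tm" where
  "count_all_courses E [] n = tick (return_tm n)"
| "count_all_courses E (k # ks) n = tick (do {
     n' \<leftarrow> count_courses (in_members E k) n;
     count_all_courses E ks n'
   })"

text \<open>
  \<open>load a\<close> is the number of courses in supercourses assigned to \<open>a\<close>, \<open>pairs\<close> the
  matching constructed so far.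
\<close>

record ('a, 'c) memory =
  ptr :: "'a \<Rightarrow> nat list"
  has :: "'a \<times> nat \<Rightarrow> bool"
  load :: "'a \<Rightarrow> nat"
  cnt :: "'c \<Rightarrow> nat"
  vis :: "nat \<Rightarrow> nat"
  stamp :: nat
  pairs :: "('a \<times> 'c) list"

fun assign_courses :: "'a \<Rightarrow> 'c list \<Rightarrow> ('a, 'c) memory \<Rightarrow> ('a, 'c) memory tm" where
  "assign_courses a [] m = tick (return_tm m)"
| "assign_courses a (c # cs) m = tick (assign_courses a cs
     (m\<lparr>cnt := (cnt m)(c := Suc (cnt m c)), load := (load m)(a := Suc (load m a)),
        pairs := (a, c) # pairs m\<rparr>))"

fun assign_all :: "('a, 'c) input \<Rightarrow> 'a \<Rightarrow> nat list \<Rightarrow> ('a, 'c) memory \<Rightarrow> ('a, 'c) memory tm" where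
  "assign_all E a [] m = tick (return_tm m)"
| "assign_all E a (k # ks) m = tick (do {
     m' \<leftarrow> assign_courses a (in_members E k) (m\<lparr>has := (has m)((a, k) := True)\<rparr>);
     assign_all E a ks m'
   })"

fun turn_tm :: "('a, 'c) input \<Rightarrow> 'a \<Rightarrow> nat list \<Rightarrow> ('a, 'c) memory \<Rightarrow> ('a, 'c) memory tm" where
  "turn_tm E a [] m = tick (return_tm (m\<lparr>ptr := (ptr m)(a := [])\<rparr>))"
| "turn_tm E a (k # ks) m = tick (
     if has m (a, k) then turn_tm E a ks m
     else do {
       open_here \<leftarrow> room_in E (cnt m) (in_members E k);
       if \<not> open_here then turn_tm E a ks m
       else do {
         let st = Suc (stamp m);
         (ds, vis') \<leftarrow> search (in_count E) (in_imm E a) st [k] (vis m) [];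
         let m' = m\<lparr>vis := vis', stamp := st\<rparr>;
         ls \<leftarrow> unassigned (has m') a ds;
         open_all \<leftarrow> room_in_all E (cnt m') ls;
         n \<leftarrow> count_all_courses E ls 0;
         if open_all \<and> load m' a + n \<le> in_acap E a
         then assign_all E a ls (m'\<lparr>ptr := (ptr m')(a := ks)\<rparr>)
         else turn_tm E a ks m'
       }
     })"

fun process_tm :: "('a, 'c) input \<Rightarrow> 'a list \<Rightarrow> ('a, 'c) memory \<Rightarrow> ('a, 'c) memory tm" where
  "process_tm E [] m = tick (return_tm m)"
| "process_tm E (a # \<sigma>) m = tick (do {
     m' \<leftarrow> turn_tm E a (ptr m a) m;
     process_tm E \<sigma> m'
   })"

definition sm_cacpr_tm :: "('a, 'c) input \<Rightarrow> 'a list \<Rightarrow> ('a \<times> 'c) list tm" where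
  "sm_cacpr_tm E \<sigma> = tick (do {
     lists \<leftarrow> build_lists E (in_applicants E) (\<lambda>_. None) (\<lambda>_. None) (\<lambda>_. []);
     m \<leftarrow> process_tm E \<sigma> \<lparr>ptr = lists, has = \<lambda>_. False, load = \<lambda>_. 0, cnt = \<lambda>_. 0,
            vis = \<lambda>_. 0, stamp = 0, pairs = []\<rparr>;
     return_tm (pairs m)
   })"

definition total_capacity :: "('a, 'c) cacpr \<Rightarrow> nat" where
  "total_capacity I = (\<Sum>a\<in>applicants I. acap I a)"

definition total_pref_length :: "('a, 'c) cacpr \<Rightarrow> nat" where
  "total_pref_length I = (\<Sum>a\<in>applicants I. length (pref I a))"

definition total_immediate_prereqs :: "('a, 'c) cacpr \<Rightarrow> nat" where
  "total_immediate_prereqs I = (\<Sum>a\<in>applicants I. card (immediate_prereq I a))"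

end

theory Submission
  imports Defs
begin

text \<open>
  Suppose that a matching \<open>M\<close> dominates the output.  By induction along the run, every applicant
  holds only supercourses from her bundle in \<open>M\<close>, and all supercourses of that bundle which her
  pointer has passed: a supercourse of \<open>M\<close> is never refused, since neither her capacity nor the
  capacities of the courses, which are occupied only by applicants who hold them in \<open>M\<close> too, can be
  exhausted; and the first time an applicant receives a supercourse \<open>X\<close> outside \<open>M\<close>, she already
  holds everything of \<open>M\<close> that she ranks above the best course of \<open>X\<close>, so that she prefers the
  output to \<open>M\<close>.  If everybody has enough turns, the output therefore equals \<open>M\<close>.

  For the running time, each entry of a supercourse list of \<open>a\<close> is examined at most once, at the cost
  of one graph search and of a bounded number of passes over disjoint sets of courses, hence
  \<open>O(n + \<Delta>\<^sub>a)\<close> where \<open>n\<close> is the number of courses and \<open>\<Delta>\<^sub>a\<close> the number of immediate prerequisites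
  of \<open>a\<close>; the list of \<open>a\<close> is no longer than \<open>n\<close> and than her preference list.
\<close>

section \<open>Sorted key lists, sums, and finite strict orders\<close>

text \<open>The locale \<open>folding_insort_key\<close> asks for injectivity of the key only on the
  given set, which is all that positions of supercourses offer. The third fact later recognises the
  list that is built course by course.\<close>

lemma (in linorder) sorted_key_list_of_set_inj_on:
  assumes "inj_on f A" "finite A"
  shows "set (sorted_key_list_of_set f A) = A"
    and "sorted_wrt (<) (map f (sorted_key_list_of_set f A))"
    and "set xs = A \<Longrightarrow> sorted_wrt (<) (map f xs) \<Longrightarrow> sorted_key_list_of_set f A = xs"
proof -
  interpret folding_insort_key "(\<le>)" "(<)" A f by standard (fact assms(1))
  show "set (sorted_key_list_of_set f A) = A" using assms by simp
  show "sorted_wrt (<) (map f (sorted_key_list_of_set f A))" by simp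
  show "sorted_key_list_of_set f A = xs" if "set xs = A" "sorted_wrt (<) (map f xs)"
    using idem_if_sorted_distinct[of xs] that by (auto simp: strict_sorted_iff distinct_map)
qed

lemma sum_Un_Diff:
  assumes "finite A" "finite B"
  shows "sum f (A \<union> B) = sum f A + sum f (B - A)"
  using sum.union_disjoint[of A "B - A" f] assms by auto

text \<open>Adds up the bounds on the turns of single applicants to a bound on the length of a
  policy.\<close>

lemma sum_count_list:
  assumes "finite A" "set xs \<subseteq> A"
  shows "(\<Sum>x\<in>A. count_list xs x) = length xs"
  using assms(2)
proof (induction xs)
  case (Cons x xs)
  have "(\<Sum>y\<in>A. count_list (x # xs) y) = (\<Sum>y\<in>A. count_list xs y + (if y = x then 1 else 0))"
    by (intro sum.cong) auto
  with Cons assms(1) show ?case by (simp add: sum.distrib)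
qed simp

lemma count_list_distinct: "distinct xs \<Longrightarrow> count_list xs x = (if x \<in> set xs then 1 else 0)"
  by (induction xs) auto

text \<open>Induction on the number of elements strictly between \<open>x\<close> and
  \<open>y\<close>: an intermediate \<open>z\<close> splits the interval into two smaller ones. This
  is why a search along immediate prerequisites finds all prerequisites.\<close>

lemma finite_strict_order_trancl_immediate:
  assumes "finite r" "irrefl r" "trans r" "(x, y) \<in> r"
  shows "(x, y) \<in> {(x, y) \<in> r. \<not> (\<exists>z. (x, z) \<in> r \<and> (z, y) \<in> r)}\<^sup>+"
  using assms(4)
proof (induction "card {z. (x, z) \<in> r \<and> (z, y) \<in> r}" arbitrary: x y rule: less_induct)
  case less
  have fin: "finite {z. (x, z) \<in> r \<and> (z, y) \<in> r}" for x y
    by (rule finite_subset[of _ "snd ` r"]) (use assms(1) in force)+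
  show ?case
  proof (cases "\<exists>z. (x, z) \<in> r \<and> (z, y) \<in> r")
    case True
    then obtain z where z: "(x, z) \<in> r" "(z, y) \<in> r" by blast
    \<comment> \<open>Transitivity gives the inclusions; \<open>z\<close> lies in the larger
      interval but, by irreflexivity, in neither smaller one.\<close>
    have "{w. (x, w) \<in> r \<and> (w, z) \<in> r} \<subset> {w. (x, w) \<in> r \<and> (w, y) \<in> r}"
      "{w. (z, w) \<in> r \<and> (w, y) \<in> r} \<subset> {w. (x, w) \<in> r \<and> (w, y) \<in> r}"
      using z assms(2,3) by (auto simp: irrefl_def dest: transD)
    then show ?thesis
      using less.hyps[OF psubset_card_mono[OF fin] z(1)] less.hyps[OF psubset_card_mono[OF fin] z(2)]
      by (blast intro: trancl_trans)
  next
    case False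
    with less.prems show ?thesis by blast
  qed
qed

section \<open>A single step of a turn, and lexicographic preference\<close>

text \<open>The acceptance test of \<open>turn\<close>, named so that case distinctions on it need
  not unfold it.\<close>

definition can_take :: "('a, 'c) cacpr \<Rightarrow> 'a \<Rightarrow> 'c set \<Rightarrow> ('a \<Rightarrow> 'c set set) \<Rightarrow> bool" where
  "can_take I a X asg \<longleftrightarrow>
     (let S = with_prereqs I a X - asg a in
      X \<notin> asg a \<and> (\<forall>c\<in>X. undersubscribed I asg c) \<and> (\<forall>c\<in>\<Union>S. \<not> full I asg c) \<and>
      (\<Sum>Y\<in>asg a. card Y) + (\<Sum>Y\<in>S. card Y) \<le> acap I a)"

text \<open>Adding only the unassigned members of \<open>with_prereqs I a X\<close> or all of them
  gives the same union, which spares later proofs the set difference.\<close>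

lemma turn_Cons:
  "turn I a (X # Xs) asg =
     (if can_take I a X asg then (Xs, asg(a := asg a \<union> with_prereqs I a X))
      else turn I a Xs asg)"
  by (simp add: can_take_def Let_def)

declare turn.simps(2) [simp del]

text \<open>The witness \<open>x\<close> need not be the best course of the symmetric difference: if
  the best one lay in \<open>B' - B\<close>, it would rank above \<open>x\<close>, against the last
  assumption.\<close>

lemma prefersI:
  assumes "B \<subseteq> acceptable I a" "B' \<subseteq> acceptable I a" "x \<in> B - B'"
    and "\<And>y. y \<in> B' - B \<Longrightarrow> \<not> ranked_above I a y x"
  shows "prefers I a B B'"
proof -
  define D where "D = (B - B') \<union> (B' - B)"
  define P where "P i \<longleftrightarrow> i < length (pref I a) \<and> pref I a ! i \<in> D" for i
  have idx: "\<exists>i. P i \<and> pref I a ! i = d" if "d \<in> D" for d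
  proof -
    from that assms(1,2) have "d \<in> set (pref I a)" by (auto simp: D_def acceptable_def)
    with that show ?thesis by (auto simp: in_set_conv_nth P_def)
  qed
  have xD: "x \<in> D" using assms(3) by (simp add: D_def)
  then have ex: "\<exists>i. P i" using idx by blast
  define c where "c = pref I a ! (LEAST i. P i)"
  have least: "P (LEAST i. P i)" using ex by (rule LeastI_ex)
  have above: "ranked_above I a c d" if "d \<in> D" "d \<noteq> c" for d
  proof -
    from idx[OF \<open>d \<in> D\<close>] obtain j where j: "P j" "pref I a ! j = d" by blast
    have "(LEAST i. P i) \<le> j" using j(1) by (rule Least_le)
    moreover have "(LEAST i. P i) \<noteq> j" using j that by (auto simp: c_def)
    ultimately have "(LEAST i. P i) < j" by simp
    with j show ?thesis by (auto simp: ranked_above_def c_def P_def)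
  qed
  have cD: "c \<in> D" using least by (simp add: P_def c_def)
  have "c \<in> B"
  proof (rule ccontr)
    assume "c \<notin> B"
    with cD have "c \<in> B' - B" by (auto simp: D_def)
    moreover from this assms(3) have "x \<noteq> c" by blast
    ultimately show False using above[OF xD] assms(4) by blast
  qed
  with above cD show ?thesis
    unfolding prefers_def Let_def D_def[symmetric] by blast
qed

section \<open>Instances, supercourses and feasible bundles\<close>

locale course_allocation =
  fixes I :: "('a, 'c) cacpr"
  assumes cacpr_instance: "cacpr_instance I"
begin

lemma finite_applicants: "finite (applicants I)"
  and finite_courses: "finite (courses I)"
  and equiv_coreq: "equiv (courses I) (coreq I)"
  using cacpr_instance by (auto simp: cacpr_instance_def)

lemma acceptable_subset: "a \<in> applicants I \<Longrightarrow> acceptable I a \<subseteq> courses I"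
  and distinct_pref: "a \<in> applicants I \<Longrightarrow> distinct (pref I a)"
  and prereq_subset: "a \<in> applicants I \<Longrightarrow> prereq I a \<subseteq> supercourses I \<times> supercourses I"
  and irrefl_prereq: "a \<in> applicants I \<Longrightarrow> irrefl (prereq I a)"
  and trans_prereq: "a \<in> applicants I \<Longrightarrow> trans (prereq I a)"
  and acap_pos: "a \<in> applicants I \<Longrightarrow> 0 < acap I a"
  using cacpr_instance by (auto simp: cacpr_instance_def)

lemma prereq_acceptable:
  "a \<in> applicants I \<Longrightarrow> (X, Y) \<in> prereq I a \<Longrightarrow> X \<subseteq> acceptable I a \<Longrightarrow> Y \<subseteq> acceptable I a"
  using cacpr_instance unfolding cacpr_instance_def by blast

lemma finite_supercourses: "finite (supercourses I)"
  unfolding supercourses_def using equiv_coreq finite_courses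
  by (intro finite_quotient) (auto simp: equiv_def refl_on_def)

lemma supercourse_nonempty: "X \<in> supercourses I \<Longrightarrow> X \<noteq> {}"
  using in_quotient_imp_non_empty[OF equiv_coreq] by (auto simp: supercourses_def)

lemma supercourse_subset: "X \<in> supercourses I \<Longrightarrow> X \<subseteq> courses I"
  using in_quotient_imp_subset[OF equiv_coreq] by (auto simp: supercourses_def)

lemma finite_supercourse: "X \<in> supercourses I \<Longrightarrow> finite X"
  using supercourse_subset finite_courses finite_subset by blast

lemma supercourse_eqI:
  "X \<in> supercourses I \<Longrightarrow> Y \<in> supercourses I \<Longrightarrow> c \<in> X \<Longrightarrow> c \<in> Y \<Longrightarrow> X = Y"
  using quotient_disj[OF equiv_coreq, of X Y] unfolding supercourses_def by blast

lemma supercourse_in: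
  "F \<subseteq> supercourses I \<Longrightarrow> X \<in> supercourses I \<Longrightarrow> c \<in> X \<Longrightarrow> c \<in> \<Union>F \<Longrightarrow> X \<in> F"
  using supercourse_eqI by blast

lemma supercourse_subset_Union_iff:
  "F \<subseteq> supercourses I \<Longrightarrow> X \<in> supercourses I \<Longrightarrow> X \<subseteq> \<Union>F \<longleftrightarrow> X \<in> F"
  using supercourse_in[of F X] supercourse_nonempty[of X] by blast

text \<open>Distinct supercourses are disjoint. This links the sums of sizes that
  \<open>turn\<close> compares with capacities to the cardinality in
  \<open>feasible\<close>.\<close>

lemma card_Union_supercourses:
  assumes "F \<subseteq> supercourses I"
  shows "card (\<Union>F) = (\<Sum>X\<in>F. card X)"
proof (rule card_Union_disjoint)
  show "pairwise disjnt F"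
    unfolding pairwise_def disjnt_def using assms supercourse_eqI by blast
  show "\<And>X. X \<in> F \<Longrightarrow> finite X" using assms finite_supercourse by blast
qed

lemma sum_card_le:
  assumes "F \<subseteq> supercourses I"
  shows "(\<Sum>X\<in>F. card X) \<le> card (courses I)"
  unfolding card_Union_supercourses[OF assms, symmetric]
  using assms supercourse_subset by (intro card_mono finite_courses) blast

text \<open>Every supercourse contributes a course of its own, since supercourses are nonempty and
  disjoint.\<close>

lemma card_le_courses:
  assumes "F \<subseteq> supercourses I"
  shows "card F \<le> card (courses I)"
proof -
  have "card F = (\<Sum>X\<in>F. 1)" by simp
  also have "\<dots> \<le> (\<Sum>X\<in>F. card X)"
  proof (rule sum_mono)
    fix X assume "X \<in> F"
    then have "X \<in> supercourses I" using assms by blast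
    then have "0 < card X" using supercourse_nonempty finite_supercourse by (simp add: card_gt_0_iff)
    then show "1 \<le> card X" by simp
  qed
  also have "\<dots> \<le> card (courses I)" by (rule sum_card_le[OF assms])
  finally show ?thesis .
qed

text \<open>By disjointness, the only member of the union that can supply \<open>c\<close> is
  \<open>X\<close> itself.\<close>

lemma feasible_supercourse_subset:
  assumes "feasible I a B" "X \<in> supercourses I" "c \<in> X" "c \<in> B"
  shows "X \<subseteq> B"
proof -
  obtain F where F: "F \<subseteq> supercourses I" "B = \<Union>F" using assms(1) unfolding feasible_def by blast
  with assms(2-4) have "X \<in> F" using supercourse_in by blast
  with F show ?thesis by blast
qed

lemma feasible_finite:
  assumes "a \<in> applicants I" "feasible I a B"
  shows "finite B"
proof (rule finite_subset)
  show "B \<subseteq> courses I" using assms acceptable_subset unfolding feasible_def by blast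
qed (rule finite_courses)

lemma with_prereqs_subset_supercourses:
  "a \<in> applicants I \<Longrightarrow> X \<in> supercourses I \<Longrightarrow> with_prereqs I a X \<subseteq> supercourses I"
  using prereq_subset[of a] unfolding with_prereqs_def by blast

lemma with_prereqs_closed:
  "a \<in> applicants I \<Longrightarrow> Y \<in> with_prereqs I a X \<Longrightarrow> with_prereqs I a Y \<subseteq> with_prereqs I a X"
  using trans_prereq[of a] unfolding with_prereqs_def by (blast dest: transD)

subsection \<open>Supercourse lists\<close>

abbreviation allowed :: "'a \<Rightarrow> 'c set set" where
  "allowed a \<equiv> {X \<in> supercourses I. X \<subseteq> acceptable I a}"

text \<open>A nonempty set of acceptable courses meets the preference list, so the
  \<open>LEAST\<close> in the position is attained.\<close>

lemma pref_supercourse_position: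
  assumes "X \<in> allowed a"
  shows "supercourse_position I a X < length (pref I a)"
    and "pref I a ! supercourse_position I a X \<in> X"
proof -
  obtain c where "c \<in> X" using assms supercourse_nonempty by blast
  with assms have "c \<in> set (pref I a)" by (auto simp: acceptable_def)
  with \<open>c \<in> X\<close> have "\<exists>i. i < length (pref I a) \<and> pref I a ! i \<in> X"
    by (auto simp: in_set_conv_nth)
  from LeastI_ex[OF this]
  show "supercourse_position I a X < length (pref I a)"
    and "pref I a ! supercourse_position I a X \<in> X"
    by (simp_all add: supercourse_position_def)
qed

lemma supercourse_position_le:
  "i < length (pref I a) \<Longrightarrow> pref I a ! i \<in> X \<Longrightarrow> supercourse_position I a X \<le> i"
  unfolding supercourse_position_def by (rule Least_le) simp

text \<open>Equal positions mean a common best course, and distinct supercourses are disjoint. Hence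
  positions can serve as sort keys.\<close>

lemma inj_on_supercourse_position: "inj_on (supercourse_position I a) (allowed a)"
proof (rule inj_onI)
  fix X Y assume "X \<in> allowed a" "Y \<in> allowed a" "supercourse_position I a X = supercourse_position I a Y"
  with pref_supercourse_position(2)[of X a] pref_supercourse_position(2)[of Y a]
  show "X = Y" using supercourse_eqI[of X Y] by auto
qed

lemma finite_allowed: "finite (allowed a)"
  using finite_supercourses by simp

lemmas set_supercourse_list =
  sorted_key_list_of_set_inj_on(1)[OF inj_on_supercourse_position finite_allowed, folded supercourse_list_def]

lemmas strict_sorted_supercourse_list =
  sorted_key_list_of_set_inj_on(2)[OF inj_on_supercourse_position finite_allowed, folded supercourse_list_def]

lemmas supercourse_list_eqI =
  sorted_key_list_of_set_inj_on(3)[OF inj_on_supercourse_position finite_allowed, folded supercourse_list_def]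

lemma distinct_supercourse_list: "distinct (supercourse_list I a)"
  using strict_sorted_supercourse_list[of a] by (auto simp: strict_sorted_iff distinct_map)

text \<open>With \<open>X\<close> at the pointer, \<open>Zs\<close> is the part of the list that the
  pointer has passed.\<close>

lemma supercourse_list_prefix:
  assumes "Zs @ X # Xs = supercourse_list I a" "Y \<in> allowed a"
    and "supercourse_position I a Y < supercourse_position I a X"
  shows "Y \<in> set Zs"
proof -
  have "Y \<in> set (Zs @ X # Xs)" using assms(1,2) set_supercourse_list by metis
  moreover have "sorted_wrt (<) (map (supercourse_position I a) (Zs @ X # Xs))"
    using strict_sorted_supercourse_list assms(1) by metis
  ultimately show ?thesis using assms(3) by (fastforce simp: sorted_wrt_append)
qed

subsection \<open>Assignments\<close>

text \<open>The invariant of the run. The load is a sum of sizes, as tested in \<open>turn\<close>;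
  by disjointness it is the size of the bundle.\<close>

definition valid :: "('a \<Rightarrow> 'c set set) \<Rightarrow> bool" where
  "valid asg \<longleftrightarrow>
     (\<forall>a\<in>applicants I. asg a \<subseteq> allowed a \<and> (\<Sum>X\<in>asg a. card X) \<le> acap I a \<and>
        (\<forall>X\<in>asg a. with_prereqs I a X \<subseteq> asg a)) \<and>
     (\<forall>c\<in>courses I. occupancy I asg c \<le> ccap I c)"

lemma valid_allowed: "valid asg \<Longrightarrow> a \<in> applicants I \<Longrightarrow> asg a \<subseteq> allowed a"
  and valid_occupancy: "valid asg \<Longrightarrow> c \<in> courses I \<Longrightarrow> occupancy I asg c \<le> ccap I c"
  unfolding valid_def by blast+

lemma valid_empty: "valid (\<lambda>_. {})"
  by (simp add: valid_def occupancy_def)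

text \<open>\<open>turn\<close> asks for \<open>undersubscribed\<close> on \<open>X\<close> but for
  \<open>\<not> full\<close> on the supercourses to be added; the two tests agree as long as no
  course is overfull.\<close>

lemma undersubscribed_iff:
  "valid asg \<Longrightarrow> c \<in> courses I \<Longrightarrow> undersubscribed I asg c \<longleftrightarrow> \<not> full I asg c"
  unfolding undersubscribed_def full_def using valid_occupancy[of asg c] by linarith

text \<open>Since \<open>a\<close> gives nothing up, the occupants of \<open>c\<close> change only
  if \<open>a\<close> joins them.\<close>

lemma occupancy_update:
  assumes "a \<in> applicants I" "asg a \<subseteq> F"
  shows "occupancy I (asg(a := F)) c = occupancy I asg c + (if c \<in> \<Union>F - \<Union>(asg a) then 1 else 0)"
proof (cases "c \<in> \<Union>F - \<Union>(asg a)")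
  case True
  then have "{b \<in> applicants I. c \<in> \<Union>((asg(a := F)) b)} = insert a {b \<in> applicants I. c \<in> \<Union>(asg b)}"
    using assms by auto
  moreover have "a \<notin> {b \<in> applicants I. c \<in> \<Union>(asg b)}" using True by simp
  ultimately show ?thesis using True finite_applicants by (simp add: occupancy_def del: Union_iff)
next
  case False
  then have "{b \<in> applicants I. c \<in> \<Union>((asg(a := F)) b)} = {b \<in> applicants I. c \<in> \<Union>(asg b)}"
    using assms by auto
  with False show ?thesis by (simp only: occupancy_def if_False add_0_right)
qed

lemma with_prereqs_allowed:
  assumes "a \<in> applicants I" "X \<in> allowed a"
  shows "with_prereqs I a X \<subseteq> allowed a"
  using assms with_prereqs_subset_supercourses[of a X] prereq_acceptable[of a X]
  by (auto simp: with_prereqs_def)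

lemma finite_assigned: "F \<subseteq> allowed a \<Longrightarrow> finite F"
  using finite_allowed by (rule finite_subset[rotated])

text \<open>A course that gains an occupant lies in an unassigned member of
  \<open>with_prereqs I a X\<close>; the test found it not full, so one more applicant fits.
  Transitivity of the prerequisites keeps the holdings closed.\<close>

lemma valid_take:
  assumes "a \<in> applicants I" "X \<in> allowed a" "valid asg" "can_take I a X asg"
  shows "valid (asg(a := asg a \<union> with_prereqs I a X))"
    (is "valid (asg(a := ?F))")
proof -
  let ?S = "with_prereqs I a X - asg a"
  have asg: "asg a \<subseteq> allowed a" and closed: "\<forall>Y\<in>asg a. with_prereqs I a Y \<subseteq> asg a"
    using assms(1,3) by (auto simp: valid_def)
  have F: "?F \<subseteq> allowed a" using asg with_prereqs_allowed[OF assms(1,2)] by blast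
  have "finite (asg a)" "finite (with_prereqs I a X)"
    using finite_assigned[OF F] by auto
  then have "(\<Sum>Y\<in>?F. card Y) = (\<Sum>Y\<in>asg a. card Y) + (\<Sum>Y\<in>?S. card Y)"
    by (rule sum_Un_Diff)
  then have cap: "(\<Sum>Y\<in>?F. card Y) \<le> acap I a"
    using assms(4) by (simp add: can_take_def Let_def)
  have F_closed: "\<forall>Y\<in>?F. with_prereqs I a Y \<subseteq> ?F"
    using closed with_prereqs_closed[OF assms(1)] by blast
  have "occupancy I (asg(a := ?F)) c \<le> ccap I c" if c: "c \<in> courses I" for c
  proof (cases "c \<in> \<Union>?F - \<Union>(asg a)")
    case True
    then have "c \<in> \<Union>?S" by blast
    then have "\<not> full I asg c" using assms(4) unfolding can_take_def Let_def by blast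
    then have "undersubscribed I asg c" using undersubscribed_iff[OF assms(3) c] by simp
    then show ?thesis using occupancy_update[of a asg ?F c] assms(1) by (auto simp: undersubscribed_def)
  next
    case False
    then have "occupancy I (asg(a := ?F)) c = occupancy I asg c"
      using occupancy_update[of a asg ?F c] assms(1) by (simp only: if_False) simp
    then show ?thesis using valid_occupancy[OF assms(3) c] by simp
  qed
  with assms(3) F cap F_closed show ?thesis by (simp add: valid_def)
qed

lemma turn_valid:
  assumes "a \<in> applicants I" "set Xs \<subseteq> allowed a" "valid asg"
  shows "valid (snd (turn I a Xs asg)) \<and> set (fst (turn I a Xs asg)) \<subseteq> set Xs"
  using assms(2,3)
proof (induction Xs)
  case (Cons X Xs)
  then show ?case using valid_take[OF assms(1), of X asg]
    by (cases "can_take I a X asg") (auto simp: turn_Cons simp del: fun_upd_apply)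
qed simp

lemma process_valid:
  assumes "set \<sigma> \<subseteq> applicants I" "\<And>a. a \<in> applicants I \<Longrightarrow> set (rest a) \<subseteq> allowed a" "valid asg"
  shows "valid (process I \<sigma> rest asg)"
  using assms
proof (induction \<sigma> arbitrary: rest asg)
  case (Cons a \<sigma>)
  obtain Xs asg' where t: "turn I a (rest a) asg = (Xs, asg')" by fastforce
  have "valid asg'" "set Xs \<subseteq> set (rest a)"
    using turn_valid[of a "rest a" asg] Cons.prems t by auto
  then have "valid (process I \<sigma> (rest(a := Xs)) asg')"
    using Cons.prems by (intro Cons.IH) (auto split: if_splits)
  with t show ?case by simp
qed simp

definition outcome :: "('a \<Rightarrow> 'c set set) \<Rightarrow> ('a \<times> 'c) set" where
  "outcome asg = {(a, c). a \<in> applicants I \<and> c \<in> \<Union>(asg a)}"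

lemma bundle_of_outcome: "a \<in> applicants I \<Longrightarrow> bundle_of (outcome asg) a = \<Union>(asg a)"
  by (auto simp: bundle_of_def outcome_def)

lemma matching_outcome:
  assumes "valid asg"
  shows "matching I (outcome asg)"
proof -
  have asg: "asg a \<subseteq> supercourses I" if "a \<in> applicants I" for a
    using valid_allowed[OF assms that] by blast
  have "feasible I a (\<Union>(asg a))" if a: "a \<in> applicants I" for a
    unfolding feasible_def
  proof (intro conjI)
    show "\<Union>(asg a) \<subseteq> acceptable I a" using valid_allowed[OF assms a] by blast
    show "card (\<Union>(asg a)) \<le> acap I a"
      using assms a card_Union_supercourses[OF asg] by (simp add: valid_def)
    show "\<exists>F\<subseteq>supercourses I. \<Union>(asg a) = \<Union>F" using asg[OF a] by blast
    show "\<forall>(X, Y)\<in>prereq I a. X \<subseteq> \<Union>(asg a) \<longrightarrow> Y \<subseteq> \<Union>(asg a)"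
    proof clarify
      fix X Y y assume XY: "(X, Y) \<in> prereq I a" and X: "X \<subseteq> \<Union>(asg a)" and "y \<in> Y"
      have "X \<in> supercourses I" using XY prereq_subset[OF a] by blast
      \<comment> \<open>A supercourse covered by the bundle is itself an assigned one, so closure of
        \<open>asg a\<close> under prerequisites applies.\<close>
      with X have "X \<in> asg a" using supercourse_subset_Union_iff[OF asg[OF a]] by blast
      then have "Y \<in> asg a" using assms a XY by (auto simp: valid_def with_prereqs_def)
      with \<open>y \<in> Y\<close> show "y \<in> \<Union>(asg a)" by blast
    qed
  qed
  moreover have "outcome asg \<subseteq> applicants I \<times> courses I"
    using asg supercourse_subset by (fastforce simp: outcome_def)
  moreover have "card {a. (a, c) \<in> outcome asg} \<le> ccap I c" if "c \<in> courses I" for c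
    using assms that by (simp add: valid_def outcome_def occupancy_def)
  ultimately show ?thesis by (simp add: matching_def bundle_of_outcome)
qed

lemma sm_cacpr_outcome: "sm_cacpr I \<sigma> = outcome (process I \<sigma> (supercourse_list I) (\<lambda>_. {}))"
  by (simp add: sm_cacpr_def outcome_def)

theorem matching_sm_cacpr:
  assumes "policy I \<sigma>"
  shows "matching I (sm_cacpr I \<sigma>)"
  unfolding sm_cacpr_outcome
  using assms
  by (intro matching_outcome process_valid)
    (auto simp: policy_def set_supercourse_list valid_empty)

subsection \<open>Pareto optimality\<close>

text \<open>Nothing is ever taken away from an applicant.\<close>

lemma process_mono: "asg a \<subseteq> process I \<sigma> rest asg a"
proof (induction \<sigma> arbitrary: rest asg)
  case (Cons b \<sigma>)
  obtain Xs asg' where t: "turn I b (rest b) asg = (Xs, asg')" by fastforce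
  have "asg a \<subseteq> snd (turn I b Ys asg) a" for Ys
    by (induction Ys) (auto simp: turn_Cons)
  then have "asg a \<subseteq> asg' a" using t by (metis snd_conv)
  with Cons.IH[of asg'] t show ?case by (auto split: prod.splits)
qed simp

text \<open>The invariant that compares the run with a competing matching \<open>M\<close>.
  \<open>Zs\<close> is the part of the list that the pointer has passed.\<close>

definition follows :: "('a \<times> 'c) set \<Rightarrow> 'c set list \<Rightarrow> ('a \<Rightarrow> 'c set set) \<Rightarrow> 'a \<Rightarrow> bool" where
  "follows M Xs asg a \<longleftrightarrow> \<Union>(asg a) \<subseteq> bundle_of M a \<and>
     (\<exists>Zs. Zs @ Xs = supercourse_list I a \<and> (\<forall>X\<in>set Zs. X \<subseteq> bundle_of M a \<longrightarrow> X \<in> asg a))"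

lemma follows_allowed: "follows M Xs asg a \<Longrightarrow> set Xs \<subseteq> allowed a"
  unfolding follows_def set_supercourse_list[symmetric] by (metis set_append Un_upper2)

text \<open>Everything that would be assigned lies in \<open>M\<close>. A full course among it would
  have its occupants and \<open>a\<close> as holders in \<open>M\<close>, one too many; and the
  tested load is at most the size of the bundle in \<open>M\<close>.\<close>

lemma can_take_matching:
  assumes a: "a \<in> applicants I" and X: "X \<in> allowed a" and "valid asg" and M: "matching I M"
    and below: "\<And>b. b \<in> applicants I \<Longrightarrow> \<Union>(asg b) \<subseteq> bundle_of M b"
    and XM: "X \<subseteq> bundle_of M a" and "X \<notin> asg a"
  shows "can_take I a X asg"
proof -
  let ?S = "with_prereqs I a X - asg a"
  have asg: "asg a \<subseteq> allowed a" using \<open>valid asg\<close> a by (auto simp: valid_def)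
  have feas: "feasible I a (bundle_of M a)" using M a by (simp add: matching_def)
  have D: "with_prereqs I a X \<subseteq> allowed a" by (rule with_prereqs_allowed[OF a X])
  have SM: "\<Union>?S \<subseteq> bundle_of M a"
    using feas XM unfolding feasible_def with_prereqs_def by blast
  have room: "\<not> full I asg c" if "c \<in> \<Union>?S" for c
  proof
    assume "full I asg c"
    have c: "c \<in> courses I" using that D supercourse_subset by blast
    let ?A = "{b \<in> applicants I. c \<in> \<Union>(asg b)}"
    \<comment> \<open>So \<open>a\<close> is not yet an occupant, and inserting her exceeds the
      capacity by one.\<close>
    have "c \<notin> \<Union>(asg a)"
      using that D asg supercourse_in[of "asg a" _ c] by blast
    then have "card (insert a ?A) = Suc (ccap I c)"
      using \<open>full I asg c\<close> finite_applicants by (simp add: full_def occupancy_def)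
    moreover have "insert a ?A \<subseteq> {b. (b, c) \<in> M}"
      using below that SM by (fastforce simp: bundle_of_def)
    moreover have "finite {b. (b, c) \<in> M}"
      using M finite_applicants by (auto simp: matching_def intro: finite_subset)
    ultimately have "Suc (ccap I c) \<le> card {b. (b, c) \<in> M}" by (metis card_mono)
    with M c show False by (auto simp: matching_def)
  qed
  have "undersubscribed I asg c" if "c \<in> X" for c
    using that room[of c] X supercourse_subset \<open>X \<notin> asg a\<close> undersubscribed_iff[OF \<open>valid asg\<close>]
    by (auto simp: with_prereqs_def)
  moreover have "(\<Sum>Y\<in>asg a. card Y) + (\<Sum>Y\<in>?S. card Y) \<le> acap I a"
  proof -
    have "finite (asg a)" "finite (with_prereqs I a X)"
      using finite_assigned[OF asg] finite_assigned[OF D] by auto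
    then have "(\<Sum>Y\<in>asg a. card Y) + (\<Sum>Y\<in>?S. card Y) = (\<Sum>Y\<in>asg a \<union> ?S. card Y)"
      by (simp add: sum_Un_Diff)
    also have "\<dots> = card (\<Union>(asg a \<union> ?S))"
      using asg D by (intro card_Union_supercourses[symmetric]) blast
    also have "\<dots> \<le> card (bundle_of M a)"
      using SM below[OF a] feasible_finite[OF a feas] by (intro card_mono) auto
    also have "\<dots> \<le> acap I a" using feas by (simp add: feasible_def)
    finally show ?thesis .
  qed
  ultimately show ?thesis using room \<open>X \<notin> asg a\<close> unfolding can_take_def Let_def by blast
qed

text \<open>\<open>B\<close> will be the bundle of \<open>a\<close> at the end of the whole run,
  which she does not prefer to that of \<open>M\<close>. A refused supercourse is outside
  \<open>M\<close> or already held; accepting one outside \<open>M\<close> would make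
  \<open>B\<close> preferable.\<close>

lemma turn_follows:
  assumes a: "a \<in> applicants I" and "valid asg" and M: "matching I M"
    and "\<And>b. b \<in> applicants I \<Longrightarrow> \<Union>(asg b) \<subseteq> bundle_of M b"
    and "follows M Xs asg a" and "\<Union>(snd (turn I a Xs asg) a) \<subseteq> B" and B: "B \<subseteq> acceptable I a"
    and np: "\<not> prefers I a B (bundle_of M a)"
  shows "follows M (fst (turn I a Xs asg)) (snd (turn I a Xs asg)) a"
  using assms(5,6)
proof (induction Xs)
  case (Cons X Xs)
  obtain Zs where Zs: "Zs @ X # Xs = supercourse_list I a"
      "\<forall>Z\<in>set Zs. Z \<subseteq> bundle_of M a \<longrightarrow> Z \<in> asg a"
    using Cons.prems(1) by (auto simp: follows_def)
  have X: "X \<in> allowed a" using set_supercourse_list[of a] Zs(1)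
    by (metis in_set_conv_decomp)
  have feas: "feasible I a (bundle_of M a)" using M a by (simp add: matching_def)
  show ?case
  proof (cases "can_take I a X asg")
    case False
    then have "X \<subseteq> bundle_of M a \<longrightarrow> X \<in> asg a"
      using can_take_matching[OF a X \<open>valid asg\<close> M assms(4)] by blast
    then have "follows M Xs asg a"
      using Zs Cons.prems(1) by (auto simp: follows_def intro!: exI[of _ "Zs @ [X]"])
    with Cons False show ?thesis by (simp add: turn_Cons)
  next
    case True
    then have sub: "\<Union>(asg a \<union> with_prereqs I a X) \<subseteq> B" using Cons.prems(2) by (simp add: turn_Cons)
    have XM: "X \<subseteq> bundle_of M a"
    proof (rule ccontr)
      assume not_sub: "\<not> X \<subseteq> bundle_of M a"
      \<comment> \<open>Not being contained in the bundle of \<open>M\<close>, \<open>X\<close> is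
        disjoint from it, so its best course can serve as the witness in
        \<open>prefersI\<close>.\<close>
      define x where "x = pref I a ! supercourse_position I a X"
      have x: "x \<in> X" using pref_supercourse_position(2)[OF X] by (simp add: x_def)
      have "x \<in> B - bundle_of M a"
        using x sub feasible_supercourse_subset[OF feas, of X x] X not_sub
        by (auto simp: with_prereqs_def)
      moreover have "\<not> ranked_above I a y x" if y: "y \<in> bundle_of M a - B" for y
      proof
        assume "ranked_above I a y x"
        then obtain i j where ij: "i < j" "j < length (pref I a)" "pref I a ! i = y" "pref I a ! j = x"
          by (auto simp: ranked_above_def)
        have "j = supercourse_position I a X"
          using ij(2,4) distinct_pref[OF a] pref_supercourse_position(1)[OF X]
          by (auto simp: x_def nth_eq_iff_index_eq)
        obtain F where "F \<subseteq> supercourses I" "bundle_of M a = \<Union>F"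
          using feas by (auto simp: feasible_def)
        with y obtain Y where Y: "Y \<in> supercourses I" "y \<in> Y" "Y \<subseteq> bundle_of M a" by blast
        then have "Y \<in> allowed a" using feas by (auto simp: feasible_def)
        moreover have "supercourse_position I a Y \<le> i"
          using ij Y(2) by (intro supercourse_position_le) auto
        \<comment> \<open>The supercourse \<open>Y\<close> of \<open>y\<close> has a better best
          course than \<open>X\<close>, hence lies before the pointer; being in \<open>M\<close>, it
          is already held, which puts \<open>y\<close> into \<open>B\<close>.\<close>
        ultimately have "Y \<in> set Zs"
          using supercourse_list_prefix[OF Zs(1)] \<open>i < j\<close> \<open>j = _\<close> by simp
        with Zs(2) Y have "y \<in> \<Union>(asg a)" by blast
        with sub y show False by blast
      qed
      moreover have "bundle_of M a \<subseteq> acceptable I a" using feas by (simp add: feasible_def)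
      ultimately show False using prefersI[OF B] np by blast
    qed
    then have "\<Union>(with_prereqs I a X) \<subseteq> bundle_of M a"
      using feas unfolding feasible_def with_prereqs_def by blast
    with True Zs Cons.prems(1) show ?thesis
      by (auto simp: follows_def turn_Cons with_prereqs_def intro!: exI[of _ "Zs @ [X]"])
  qed
qed simp

text \<open>An unsuccessful turn exhausts the list; a successful one consumes an entry and adds at
  least one course. This pays for the turn in the last assumption of
  \<open>process_follows\<close>.\<close>

lemma turn_progress:
  assumes "a \<in> applicants I" "set Xs \<subseteq> allowed a" "valid asg"
  shows "turn I a Xs asg = ([], asg) \<or>
    length (fst (turn I a Xs asg)) < length Xs \<and>
    (\<Sum>X\<in>asg a. card X) < (\<Sum>X\<in>snd (turn I a Xs asg) a. card X)"
  using assms(2)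
proof (induction Xs)
  case (Cons X Xs)
  show ?case
  proof (cases "can_take I a X asg")
    case True
    have X: "X \<in> allowed a" using Cons.prems by simp
    have "asg a \<subseteq> allowed a" using assms(1,3) by (auto simp: valid_def)
    then have fin: "finite (asg a \<union> with_prereqs I a X)"
      using with_prereqs_allowed[OF assms(1) X] by (intro finite_assigned) blast
    have "X \<in> (asg a \<union> with_prereqs I a X) - asg a"
      using True by (auto simp: can_take_def Let_def with_prereqs_def)
    moreover have "0 < card X"
      using X supercourse_nonempty finite_supercourse by (auto simp: card_gt_0_iff)
    ultimately have "(\<Sum>X\<in>asg a. card X) < (\<Sum>X\<in>asg a \<union> with_prereqs I a X. card X)"
      using fin by (intro sum_strict_mono2) auto
    with True show ?thesis by (simp add: turn_Cons)
  next
    case False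
    with Cons show ?thesis by (auto simp: turn_Cons)
  qed
qed simp

lemma turn_other: "b \<noteq> a \<Longrightarrow> snd (turn I a Xs asg) b = asg b"
  by (induction Xs) (auto simp: turn_Cons)

text \<open>The last assumption says that the remaining turns of \<open>b\<close> suffice to finish
  her list or to fill her capacity. At the end no turn remains: with the list finished, she holds
  all of \<open>M\<close>; with the capacity reached, her bundle lies inside that of
  \<open>M\<close> and is no smaller.\<close>

lemma process_follows:
  fixes \<sigma> rest asg
  defines "fin \<equiv> process I \<sigma> rest asg"
  assumes "set \<sigma> \<subseteq> applicants I" "valid asg" and M: "matching I M"
    and "\<And>b. b \<in> applicants I \<Longrightarrow> follows M (rest b) asg b"
    and "\<And>b. b \<in> applicants I \<Longrightarrow> \<not> prefers I b (\<Union>(fin b)) (bundle_of M b)"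
    and b: "b \<in> applicants I"
    and "length (rest b) \<le> count_list \<sigma> b \<or> acap I b \<le> (\<Sum>X\<in>asg b. card X) + count_list \<sigma> b"
  shows "\<Union>(fin b) = bundle_of M b"
  using assms(2,3,5,6,8) unfolding fin_def
proof (induction \<sigma> arbitrary: rest asg)
  case Nil
  have feas: "feasible I b (bundle_of M b)" using M b by (simp add: matching_def)
  have fol: "follows M (rest b) asg b" using Nil b by blast
  then have below: "\<Union>(asg b) \<subseteq> bundle_of M b" by (simp add: follows_def)
  have asg: "asg b \<subseteq> allowed b" using Nil b by (auto simp: valid_def)
  show ?case
  proof (cases "rest b = []")
    case True
    with fol have "\<forall>X\<in>allowed b. X \<subseteq> bundle_of M b \<longrightarrow> X \<in> asg b"
      by (auto simp: follows_def set_supercourse_list)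
    moreover obtain F where "F \<subseteq> supercourses I" "bundle_of M b = \<Union>F"
      using feas by (auto simp: feasible_def)
    moreover have "bundle_of M b \<subseteq> acceptable I b" using feas by (simp add: feasible_def)
    ultimately show ?thesis using below by fastforce
  next
    case False
    then have "acap I b \<le> (\<Sum>X\<in>asg b. card X)" using Nil by auto
    also have "\<dots> = card (\<Union>(asg b))" using asg by (intro card_Union_supercourses[symmetric]) blast
    finally have "card (bundle_of M b) \<le> card (\<Union>(asg b))" using feas by (simp add: feasible_def)
    moreover have "finite (bundle_of M b)"
      by (rule feasible_finite[OF b feas])
    ultimately show ?thesis using below by (simp add: card_seteq)
  qed
next
  case (Cons a \<sigma>)
  obtain Xs asg' where t: "turn I a (rest a) asg = (Xs, asg')" by fastforce
  define p where "p = rest(a := Xs)"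
  have pr: "process I (a # \<sigma>) rest asg = process I \<sigma> p asg'" by (simp add: t p_def)
  have a: "a \<in> applicants I" using Cons.prems by simp
  have "follows M (rest a) asg a" using Cons.prems a by blast
  then have rest: "set (rest a) \<subseteq> allowed a" by (rule follows_allowed)
  have "valid asg'" using turn_valid[OF a rest] Cons.prems t by (metis snd_conv)
  have other: "asg' b = asg b" if "b \<noteq> a" for b using turn_other[OF that] t by (metis snd_conv)
  have final: "valid (process I \<sigma> p asg')"
  proof (rule process_valid)
    show "set (p b) \<subseteq> allowed b" if "b \<in> applicants I" for b
      using follows_allowed[OF Cons.prems(3)[OF that]] turn_valid[OF a rest Cons.prems(2)] rest t
      by (auto simp: p_def)
  qed (use Cons.prems \<open>valid asg'\<close> in auto)
  have "\<Union>(process I \<sigma> p asg' a) \<subseteq> acceptable I a" using valid_allowed[OF final a] by blast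
  \<comment> \<open>Holdings only grow, so the final bundle can play the role of \<open>B\<close> in
    \<open>turn_follows\<close> at every turn.\<close>
  moreover have "\<Union>(asg' a) \<subseteq> \<Union>(process I \<sigma> p asg' a)"
    using process_mono[of asg' a \<sigma> p] by blast
  moreover have "\<not> prefers I a (\<Union>(process I \<sigma> p asg' a)) (bundle_of M a)"
    using Cons.prems(4)[OF a] pr by simp
  moreover have "\<And>b. b \<in> applicants I \<Longrightarrow> \<Union>(asg b) \<subseteq> bundle_of M b"
    using Cons.prems(3) by (simp add: follows_def)
  ultimately have fol: "follows M Xs asg' a"
    using turn_follows[OF a Cons.prems(2) M, of "rest a" "\<Union>(process I \<sigma> p asg' a)"]
      Cons.prems(3)[OF a] t by simp
  have fol': "follows M (p b) asg' b" if "b \<in> applicants I" for b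
    using that fol Cons.prems(3)[OF that] other by (auto simp: p_def follows_def)
  \<comment> \<open>A turn of \<open>b\<close> uses up one of her counted turns, and it shortens her
    list while raising her load, or leaves the list empty; turns of others change none of
    this.\<close>
  have "length (p b) \<le> count_list \<sigma> b \<or> acap I b \<le> (\<Sum>X\<in>asg' b. card X) + count_list \<sigma> b"
    using Cons.prems(5) turn_progress[OF a rest Cons.prems(2)] t other[of b]
    by (cases "b = a") (auto simp: p_def)
  then show ?case
    unfolding pr using Cons.prems fol' \<open>valid asg'\<close> pr by (intro Cons.IH) auto
qed

theorem pareto_optimal_sm_cacpr:
  assumes "complete_policy I \<sigma>"
  shows "pareto_optimal I (sm_cacpr I \<sigma>)"
proof -
  let ?asg = "process I \<sigma> (supercourse_list I) (\<lambda>_. {})"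
  have pol: "policy I \<sigma>" using assms by (simp add: complete_policy_def)
  have False if M: "matching I M" and dom: "dominates I M (sm_cacpr I \<sigma>)" for M
  proof -
    have "\<Union>(?asg b) = bundle_of M b" if b: "b \<in> applicants I" for b
    proof (rule process_follows[OF _ valid_empty M _ _ b])
      show "set \<sigma> \<subseteq> applicants I" using pol by (simp add: policy_def)
      show "follows M (supercourse_list I b) (\<lambda>_. {}) b" for b by (simp add: follows_def)
      show "\<not> prefers I b (\<Union>(?asg b)) (bundle_of M b)" if "b \<in> applicants I" for b
        using dom that by (auto simp: dominates_def sm_cacpr_outcome bundle_of_outcome)
      show "length (supercourse_list I b) \<le> count_list \<sigma> b \<or>
          acap I b \<le> (\<Sum>X\<in>{}. card X) + count_list \<sigma> b"
        using assms b by (auto simp: complete_policy_def)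
    qed
    moreover obtain b where "b \<in> applicants I" "prefers I b (bundle_of M b) (\<Union>(?asg b))"
      using dom by (auto simp: dominates_def sm_cacpr_outcome bundle_of_outcome)
    \<comment> \<open>\<open>b\<close> would prefer a bundle to itself, but the symmetric difference
      is empty.\<close>
    ultimately show False by (simp add: prefers_def)
  qed
  with matching_sm_cacpr[OF pol] show ?thesis by (auto simp: pareto_optimal_def)
qed

end

subsection \<open>Steps and values of the loops\<close>

lemma val_simps [simp]:
  "val (bind_tm m f) = val (f (val m))" "val (return_tm x) = x" "val (tick m) = val m"
  by (simp_all add: bind_tm_def return_tm_def tick_def)

lemma steps_simps [simp]:
  "steps (bind_tm m f) = steps m + steps (f (val m))" "steps (return_tm x) = 0"
  "steps (tick m) = Suc (steps m)"
  by (simp_all add: bind_tm_def return_tm_def tick_def)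

lemma mark_acceptable:
  "val (mark_acceptable a cs acc) = (\<lambda>c. if c \<in> set cs then Some a else acc c)"
  "steps (mark_acceptable a cs acc) = Suc (length cs)"
  by (induction cs arbitrary: acc) auto

lemma all_marked:
  "val (all_marked a acc cs) \<longleftrightarrow> (\<forall>c\<in>set cs. acc c = Some a)"
  "steps (all_marked a acc cs) \<le> Suc (length cs)"
  by (induction cs) auto

lemma push_all:
  "val (push_all ks stk) = rev ks @ stk" "steps (push_all ks stk) = Suc (length ks)"
  by (induction ks arbitrary: stk) auto

lemma unassigned:
  "val (unassigned h a ks) = filter (\<lambda>k. \<not> h (a, k)) ks"
  "steps (unassigned h a ks) = Suc (length ks)"
  by (induction ks) auto

lemma room_in:
  "val (room_in E n cs) \<longleftrightarrow> (\<forall>c\<in>set cs. n c < in_ccap E c)"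
  "steps (room_in E n cs) \<le> Suc (length cs)"
  by (induction cs) auto

text \<open>Cost of one pass over all members of the listed supercourses: per supercourse one step
  for its entry, one per member and one to end the inner loop; one more step ends the outer
  loop.\<close>

definition members_steps :: "('a, 'c) input \<Rightarrow> nat list \<Rightarrow> nat" where
  "members_steps E ks = Suc (\<Sum>k\<leftarrow>ks. length (in_members E k) + 2)"

lemma members_steps_simps [simp]:
  "members_steps E [] = 1"
  "members_steps E (k # ks) = length (in_members E k) + 2 + members_steps E ks"
  by (simp_all add: members_steps_def)

lemma room_in_all:
  "val (room_in_all E n ks) \<longleftrightarrow> (\<forall>k\<in>set ks. \<forall>c\<in>set (in_members E k). n c < in_ccap E c)"
  "steps (room_in_all E n ks) \<le> members_steps E ks"
proof (induction ks)
  case (Cons k ks)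
  case 2
  with Cons room_in(2)[of E n "in_members E k"] show ?case by auto
qed (auto simp: room_in)

lemma count_courses:
  "val (count_courses cs n) = n + length cs" "steps (count_courses cs n) = Suc (length cs)"
  by (induction cs arbitrary: n) auto

lemma count_all_courses:
  "val (count_all_courses E ks n) = n + (\<Sum>k\<leftarrow>ks. length (in_members E k))"
  "steps (count_all_courses E ks n) = members_steps E ks"
  by (induction ks arbitrary: n) (auto simp: count_courses)

lemma assign_courses:
  "val (assign_courses a cs m) =
     m\<lparr>cnt := \<lambda>c. cnt m c + count_list cs c, load := (load m)(a := load m a + length cs),
       pairs := rev (map (Pair a) cs) @ pairs m\<rparr>"
  "steps (assign_courses a cs m) = Suc (length cs)"
  by (induction cs arbitrary: m) (auto intro!: memory.equality)

lemma assign_all: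
  "val (assign_all E a ks m) =
     m\<lparr>has := \<lambda>p. has m p \<or> p \<in> Pair a ` set ks,
       cnt := \<lambda>c. cnt m c + count_list (concat (map (in_members E) ks)) c,
       load := (load m)(a := load m a + (\<Sum>k\<leftarrow>ks. length (in_members E k))),
       pairs := rev (map (Pair a) (concat (map (in_members E) ks))) @ pairs m\<rparr>"
  "steps (assign_all E a ks m) = members_steps E ks"
  by (induction ks arbitrary: m) (auto simp: assign_courses intro!: memory.equality)

text \<open>
  The visited vertices are exactly the collected ones; a visited vertex has all its successors
  visited or on the stack.
\<close>

lemma search_correct:
  fixes r adj st stk v out
  defines "R \<equiv> val (search r adj st stk v out)"
  assumes "\<And>k. k < r \<Longrightarrow> set (adj k) \<subseteq> {..<r}" "set stk \<subseteq> {..<r}"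
    and "set out = {k. k < r \<and> v k = st}" "distinct out"
    and "\<And>k. k \<in> set out \<Longrightarrow> set (adj k) \<subseteq> set out \<union> set stk"
  shows "distinct (fst R) \<and> set (fst R) \<subseteq> {..<r} \<and> set out \<union> set stk \<subseteq> set (fst R) \<and>
    (\<forall>k\<in>set (fst R). set (adj k) \<subseteq> set (fst R)) \<and>
    (\<forall>C. set out \<union> set stk \<subseteq> C \<longrightarrow> (\<forall>k\<in>C. set (adj k) \<subseteq> C) \<longrightarrow> set (fst R) \<subseteq> C)"
  using assms(2-) unfolding R_def
proof (induction r adj st stk v out rule: search.induct)
  case (1 r adj st v out)
  then show ?case by auto
next
  case (2 r adj st k stk v out)
  show ?case
  proof (cases "k < r \<and> v k \<noteq> st")
    case True
    define R where "R = val (search r adj st (rev (adj k) @ stk) (v(k := st)) (k # out))"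
    have "distinct (fst R) \<and> set (fst R) \<subseteq> {..<r} \<and>
      set (k # out) \<union> set (rev (adj k) @ stk) \<subseteq> set (fst R) \<and>
      (\<forall>k\<in>set (fst R). set (adj k) \<subseteq> set (fst R)) \<and>
      (\<forall>C. set (k # out) \<union> set (rev (adj k) @ stk) \<subseteq> C \<longrightarrow> (\<forall>k\<in>C. set (adj k) \<subseteq> C) \<longrightarrow>
         set (fst R) \<subseteq> C)"
      unfolding R_def
    proof (rule "2.IH"(1)[OF True])
      show "rev (adj k) @ stk = val (push_all (adj k) stk)" by (simp add: push_all)
      show "\<And>l. l < r \<Longrightarrow> set (adj l) \<subseteq> {..<r}" by (rule "2.prems"(1))
      show "set (rev (adj k) @ stk) \<subseteq> {..<r}" using "2.prems"(1)[of k] "2.prems"(2) True by auto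
      show "set (k # out) = {l. l < r \<and> (v(k := st)) l = st}" using "2.prems"(3) True by auto
      show "distinct (k # out)" using "2.prems"(3,4) True by auto
      show "set (adj l) \<subseteq> set (k # out) \<union> set (rev (adj k) @ stk)" if "l \<in> set (k # out)" for l
        using "2.prems"(5)[of l] that by auto
    qed
    moreover have "val (search r adj st (k # stk) v out) = R"
      using True by (simp add: push_all R_def)
    ultimately show ?thesis by auto
  next
    case False
    \<comment> \<open>Stack entries are below \<open>r\<close>, so the test can only fail because
      \<open>k\<close> is already visited, hence collected.\<close>
    then have k: "k \<in> set out" using "2.prems"(2,3) by auto
    define R where "R = val (search r adj st stk v out)"
    have "distinct (fst R) \<and> set (fst R) \<subseteq> {..<r} \<and> set out \<union> set stk \<subseteq> set (fst R) \<and>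
      (\<forall>k\<in>set (fst R). set (adj k) \<subseteq> set (fst R)) \<and>
      (\<forall>C. set out \<union> set stk \<subseteq> C \<longrightarrow> (\<forall>k\<in>C. set (adj k) \<subseteq> C) \<longrightarrow> set (fst R) \<subseteq> C)"
      unfolding R_def
    proof (rule "2.IH"(2)[OF False "2.prems"(1) _ "2.prems"(3,4)])
      show "set stk \<subseteq> {..<r}" using "2.prems"(2) by simp
      show "set (adj l) \<subseteq> set out \<union> set stk" if "l \<in> set out" for l
        using "2.prems"(5)[OF that] k by (simp add: insert_absorb)
    qed
    moreover have "val (search r adj st (k # stk) v out) = R"
      using False by (auto simp: R_def)
    ultimately show ?thesis using k by auto
  qed
qed

lemma search_vis:
  "snd (val (search r adj st stk v out)) k = v k \<or> snd (val (search r adj st stk v out)) k = st"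
proof (induction r adj st stk v out rule: search.induct)
  case (2 r adj st l stk v out)
  then show ?case
    by (cases "l < r \<and> v l \<noteq> st") (auto simp: fun_upd_def split: if_splits)
qed simp

text \<open>Each entry now on the stack pays for its own removal. A vertex visited for the first
  time pays one step for ending the push loop and two for each neighbour, which is pushed and later
  removed.\<close>

lemma search_steps:
  "steps (search r adj st stk v out) \<le>
     Suc (length stk) + (\<Sum>k | k < r \<and> v k \<noteq> st. 1 + 2 * length (adj k))"
proof (induction r adj st stk v out rule: search.induct)
  case (2 r adj st k stk v out)
  show ?case
  proof (cases "k < r \<and> v k \<noteq> st")
    case True
    have "{l. l < r \<and> v l \<noteq> st} = insert k {l. l < r \<and> (v(k := st)) l \<noteq> st}"
      using True by auto
    then have "(\<Sum>l | l < r \<and> v l \<noteq> st. 1 + 2 * length (adj l)) =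
        (1 + 2 * length (adj k)) + (\<Sum>l | l < r \<and> (v(k := st)) l \<noteq> st. 1 + 2 * length (adj l))"
      by simp
    with "2.IH"(1)[OF True refl] True show ?thesis by (simp add: push_all del: fun_upd_apply)
  next
    case False
    have "steps (search r adj st (k # stk) v out) = Suc (steps (search r adj st stk v out))"
      using False by auto
    with "2.IH"(2)[OF False] show ?thesis by simp
  qed
qed simp

lemma process_Cons:
  "process I (a # \<sigma>) rest asg =
     process I \<sigma> (rest(a := fst (turn I a (rest a) asg))) (snd (turn I a (rest a) asg))"
  by (simp add: split_beta Let_def)

section \<open>Stored instances and their numbered supercourses\<close>

locale encoded_course_allocation = course_allocation I
  for I :: "('a, 'c) cacpr" +
  fixes E :: "('a, 'c) input"
  assumes encodes: "encodes E I"
begin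

abbreviation "r \<equiv> in_count E"
abbreviation "cls k \<equiv> set (in_members E k)"

lemma in_applicants: "distinct (in_applicants E)" "set (in_applicants E) = applicants I"
  using encodes by (simp_all add: encodes_def)

lemma in_acap: "a \<in> applicants I \<Longrightarrow> in_acap E a = acap I a"
  and in_pref: "a \<in> applicants I \<Longrightarrow> in_pref E a = pref I a"
  and in_ccap: "c \<in> courses I \<Longrightarrow> in_ccap E c = ccap I c"
  and distinct_members: "k < r \<Longrightarrow> distinct (in_members E k)"
  and in_class: "k < r \<Longrightarrow> c \<in> cls k \<Longrightarrow> in_class E c = k"
  and in_imm_less: "a \<in> applicants I \<Longrightarrow> k < r \<Longrightarrow> set (in_imm E a k) \<subseteq> {..<r}"
  and distinct_in_imm: "a \<in> applicants I \<Longrightarrow> k < r \<Longrightarrow> distinct (in_imm E a k)"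
  and in_imm: "a \<in> applicants I \<Longrightarrow> k < r \<Longrightarrow>
    cls ` set (in_imm E a k) = {Y. (cls k, Y) \<in> immediate_prereq I a}"
  using encodes by (simp_all add: encodes_def)

lemma bij_cls: "bij_betw cls {..<r} (supercourses I)"
  using encodes by (simp add: encodes_def)

lemma inj_cls: "inj_on cls {..<r}"
  and image_cls: "cls ` {..<r} = supercourses I"
  using bij_cls by (simp_all add: bij_betw_def)

lemma cls_supercourse: "k < r \<Longrightarrow> cls k \<in> supercourses I"
  using image_cls by blast

lemma cls_in_image: "k < r \<Longrightarrow> K \<subseteq> {..<r} \<Longrightarrow> cls k \<in> cls ` K \<longleftrightarrow> k \<in> K"
  using inj_on_image_mem_iff[OF inj_cls] by simp

lemma in_class_less:
  assumes "c \<in> courses I"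
  shows "in_class E c < r" "c \<in> cls (in_class E c)"
proof -
  obtain X where "X \<in> supercourses I" "c \<in> X"
    using assms Union_quotient[OF equiv_coreq] by (auto simp: supercourses_def)
  then obtain k where "k < r" "c \<in> cls k" using image_cls by blast
  with in_class show "in_class E c < r" "c \<in> cls (in_class E c)" by auto
qed

lemma r_le_courses: "r \<le> card (courses I)"
  using bij_betw_same_card[OF bij_cls] card_le_courses[OF subset_refl] by simp

lemma length_members: "k < r \<Longrightarrow> length (in_members E k) = card (cls k)"
  by (simp add: distinct_card distinct_members)

lemma length_members_le: "k < r \<Longrightarrow> length (in_members E k) \<le> card (courses I)"
  unfolding length_members
  using supercourse_subset[OF cls_supercourse] finite_courses by (intro card_mono)

lemma sum_list_length_members:
  assumes "distinct ks" "set ks \<subseteq> {..<r}"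
  shows "(\<Sum>k\<leftarrow>ks. length (in_members E k)) = (\<Sum>X\<in>cls ` set ks. card X)"
proof -
  have "(\<Sum>k\<leftarrow>ks. length (in_members E k)) = (\<Sum>k\<in>set ks. length (in_members E k))"
    using assms(1) by (rule sum_list_distinct_conv_sum_set)
  also have "\<dots> = (\<Sum>k\<in>set ks. card (cls k))"
    using assms(2) by (intro sum.cong) (auto simp: length_members)
  also have "\<dots> = (\<Sum>X\<in>cls ` set ks. card X)"
    using inj_on_subset[OF inj_cls assms(2)] by (simp add: sum.reindex)
  finally show ?thesis .
qed

lemma length_le_courses:
  assumes "distinct ks" "set ks \<subseteq> {..<r}"
  shows "length ks \<le> card (courses I)"
  using distinct_card[OF assms(1)] card_mono[OF _ assms(2)] r_le_courses by simp

text \<open>The listed supercourses have at most \<open>card (courses I)\<close> members in total,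
  and there are at most as many of them, each costing two further steps.\<close>

lemma members_steps_le:
  assumes "distinct ks" "set ks \<subseteq> {..<r}"
  shows "members_steps E ks \<le> 1 + 3 * card (courses I)"
proof -
  have "members_steps E ks = Suc ((\<Sum>k\<leftarrow>ks. length (in_members E k)) + 2 * length ks)"
    by (induction ks) auto
  moreover have "(\<Sum>k\<leftarrow>ks. length (in_members E k)) \<le> card (courses I)"
    unfolding sum_list_length_members[OF assms]
    using assms(2) image_cls by (intro sum_card_le) blast
  ultimately show ?thesis using length_le_courses[OF assms] by linarith
qed

text \<open>Different supercourses share no course, so assigning \<open>ks\<close> raises the
  counter of a course at most once.\<close>

lemma distinct_concat_members:
  assumes "distinct ks" "set ks \<subseteq> {..<r}"
  shows "distinct (concat (map (in_members E) ks))"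
  using assms
proof (induction ks)
  case (Cons k ks)
  have "cls k \<inter> cls l = {}" if "l \<in> set ks" for l
  proof -
    have "k < r" "l < r" "l \<noteq> k" using that Cons.prems by auto
    then show ?thesis using in_class by blast
  qed
  with Cons show ?case by (auto simp: distinct_members)
qed simp

subsection \<open>Searching for prerequisites\<close>

text \<open>The search returns the least set that contains \<open>k\<close> and is closed under
  immediate prerequisites. By transitivity \<open>k\<close> and its prerequisites form such a set,
  and conversely each prerequisite is reached by a chain of immediate ones.\<close>

lemma with_prereqs_search:
  assumes a: "a \<in> applicants I" and k: "k < r" and st: "\<And>l. v l < st"
  defines "ds \<equiv> fst (val (search r (in_imm E a) st [k] v []))"
  shows "distinct ds" "set ds \<subseteq> {..<r}" "cls ` set ds = with_prereqs I a (cls k)"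
proof -
  have *: "distinct ds \<and> set ds \<subseteq> {..<r} \<and> set [] \<union> set [k] \<subseteq> set ds \<and>
      (\<forall>l\<in>set ds. set (in_imm E a l) \<subseteq> set ds) \<and>
      (\<forall>C. set [] \<union> set [k] \<subseteq> C \<longrightarrow> (\<forall>l\<in>C. set (in_imm E a l) \<subseteq> C) \<longrightarrow> set ds \<subseteq> C)"
    unfolding ds_def
  proof (rule search_correct)
    show "\<And>l. l < r \<Longrightarrow> set (in_imm E a l) \<subseteq> {..<r}" using in_imm_less[OF a] .
    \<comment> \<open>As all marks are below \<open>st\<close>, nothing counts as visited at the
      start.\<close>
    show "set [] = {l. l < r \<and> v l = st}" using st by (auto simp: less_le)
  qed (use k in auto)
  then show "distinct ds" and ds: "set ds \<subseteq> {..<r}" by simp_all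
  have k_ds: "k \<in> set ds" and closed: "\<And>l. l \<in> set ds \<Longrightarrow> set (in_imm E a l) \<subseteq> set ds"
    and least: "\<And>C. k \<in> C \<Longrightarrow> (\<And>l. l \<in> C \<Longrightarrow> set (in_imm E a l) \<subseteq> C) \<Longrightarrow> set ds \<subseteq> C"
    using * by simp_all
  show "cls ` set ds = with_prereqs I a (cls k)"
  proof
    let ?C = "{l. l < r \<and> cls l \<in> with_prereqs I a (cls k)}"
    have "set (in_imm E a l) \<subseteq> ?C" if l: "l \<in> ?C" for l
    proof
      fix j assume j: "j \<in> set (in_imm E a l)"
      have "l < r" using l by simp
      have "(cls l, cls j) \<in> immediate_prereq I a" using in_imm[OF a \<open>l < r\<close>] j by blast
      then have "cls j \<in> with_prereqs I a (cls l)" by (simp add: immediate_prereq_def with_prereqs_def)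
      then have "cls j \<in> with_prereqs I a (cls k)"
        using with_prereqs_closed[OF a, of "cls l" "cls k"] l by blast
      then show "j \<in> ?C" using j in_imm_less[OF a \<open>l < r\<close>] by blast
    qed
    moreover have "k \<in> ?C" using k by (simp add: with_prereqs_def)
    ultimately have "set ds \<subseteq> ?C" by (rule least[rotated])
    then show "cls ` set ds \<subseteq> with_prereqs I a (cls k)" by blast
    have "finite (prereq I a)"
      using prereq_subset[OF a] by (rule finite_subset) (simp add: finite_supercourses)
    then have tr: "(X, Y) \<in> (immediate_prereq I a)\<^sup>+" if "(X, Y) \<in> prereq I a" for X Y
      using finite_strict_order_trancl_immediate[OF _ irrefl_prereq[OF a] trans_prereq[OF a] that]
      by (simp add: immediate_prereq_def)
    have step: "Y \<in> cls ` set ds" if X: "X \<in> cls ` set ds" and XY: "(X, Y) \<in> immediate_prereq I a" for X Y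
    proof -
      obtain l where l: "l \<in> set ds" "X = cls l" using X by blast
      moreover have "l < r" using l ds by blast
      ultimately have "Y \<in> cls ` set (in_imm E a l)" using in_imm[OF a] XY by simp
      then show ?thesis using closed[OF l(1)] by blast
    qed
    have "Y \<in> cls ` set ds" if "(cls k, Y) \<in> (immediate_prereq I a)\<^sup>+" for Y
      using that
    proof (induction rule: trancl_induct)
      case (base Y)
      then show ?case using step[of "cls k"] k_ds by simp
    qed (rule step)
    then show "with_prereqs I a (cls k) \<subseteq> cls ` set ds"
      using tr k_ds by (auto simp: with_prereqs_def)
  qed
qed

text \<open>The adjacency lists are duplicate-free and the numbering is injective, so their lengths
  count the pairs of the relation, grouped by first component.\<close>

lemma sum_in_imm:
  assumes "a \<in> applicants I"
  shows "(\<Sum>k<r. length (in_imm E a k)) = card (immediate_prereq I a)"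
proof -
  have sub: "immediate_prereq I a \<subseteq> supercourses I \<times> supercourses I"
    using prereq_subset[OF assms] by (auto simp: immediate_prereq_def)
  have "(\<Sum>k<r. length (in_imm E a k)) = (\<Sum>k<r. card {Y. (cls k, Y) \<in> immediate_prereq I a})"
  proof (rule sum.cong)
    fix k assume "k \<in> {..<r}"
    then have k: "k < r" by simp
    have "length (in_imm E a k) = card (set (in_imm E a k))"
      using distinct_in_imm[OF assms k] by (simp add: distinct_card)
    also have "\<dots> = card (cls ` set (in_imm E a k))"
      using inj_on_subset[OF inj_cls in_imm_less[OF assms k]] by (simp add: card_image)
    finally show "length (in_imm E a k) = card {Y. (cls k, Y) \<in> immediate_prereq I a}"
      unfolding in_imm[OF assms k] .
  qed simp
  also have "\<dots> = (\<Sum>X\<in>supercourses I. card {Y. (X, Y) \<in> immediate_prereq I a})"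
    using sum.reindex_bij_betw[OF bij_cls, of "\<lambda>X. card {Y. (X, Y) \<in> immediate_prereq I a}"] by simp
  also have "\<dots> = card (SIGMA X:supercourses I. {Y. (X, Y) \<in> immediate_prereq I a})"
  proof (rule card_SigmaI[symmetric])
    show "\<forall>X\<in>supercourses I. finite {Y. (X, Y) \<in> immediate_prereq I a}"
      using sub by (intro ballI finite_subset[OF _ finite_supercourses]) blast
  qed (rule finite_supercourses)
  also have "(SIGMA X:supercourses I. {Y. (X, Y) \<in> immediate_prereq I a}) = immediate_prereq I a"
    using sub by auto
  finally show ?thesis .
qed

lemma search_steps_le:
  assumes "a \<in> applicants I"
  shows "steps (search r (in_imm E a) st [k] v []) \<le>
    2 + card (courses I) + 2 * card (immediate_prereq I a)"
proof -
  have "(\<Sum>l | l < r \<and> v l \<noteq> st. 1 + 2 * length (in_imm E a l)) \<le> (\<Sum>l<r. 1 + 2 * length (in_imm E a l))"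
    by (intro sum_mono2) auto
  also have "\<dots> = r + 2 * card (immediate_prereq I a)"
    unfolding sum_in_imm[OF assms, symmetric] sum_distrib_left sum.distrib by simp
  finally show ?thesis using search_steps[of r "in_imm E a" st "[k]" v "[]"] r_le_courses by simp
qed

subsection \<open>Building the supercourse lists\<close>

text \<open>\<open>pre\<close> is the part of the preference list already read, its supercourses
  being marked in \<open>seen\<close>. A supercourse is entered at its best course, so entries come
  in order of position. Each course costs its own step and at most
  \<open>1 + card (courses I)\<close> for the check.\<close>

lemma build_list:
  assumes a: "a \<in> applicants I" and acc: "\<And>c. acc c = Some a \<longleftrightarrow> c \<in> acceptable I a"
    and "pre @ cs = pref I a" and "\<And>k. seen k = Some a \<longleftrightarrow> k \<in> in_class E ` set pre"
  shows "set (fst (val (build_list E a acc cs seen))) =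
      {k \<in> in_class E ` set cs - in_class E ` set pre. cls k \<subseteq> acceptable I a} \<and>
    sorted_wrt (<) (map (\<lambda>k. supercourse_position I a (cls k)) (fst (val (build_list E a acc cs seen)))) \<and>
    steps (build_list E a acc cs seen) \<le> Suc (length cs * (2 + card (courses I)))"
  using assms(3,4)
proof (induction cs arbitrary: pre seen)
  case (Cons c cs)
  define k where "k = in_class E c"
  have pre': "(pre @ [c]) @ cs = pref I a" using Cons.prems(1) by simp
  have "c \<in> courses I"
    using Cons.prems(1) acceptable_subset[OF a] unfolding acceptable_def by (metis in_set_conv_decomp subsetD)
  then have k: "k < r" "c \<in> cls k" using in_class_less by (simp_all add: k_def)
  show ?case
  proof (cases "seen k = Some a")
    case True
    then have "k \<in> in_class E ` set pre" using Cons.prems(2) by simp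
    then have "\<And>l. seen l = Some a \<longleftrightarrow> l \<in> in_class E ` set (pre @ [c])"
      using Cons.prems(2) by (auto simp: k_def)
    from Cons.IH[OF pre' this] True \<open>k \<in> _\<close> show ?thesis
      by (auto simp: k_def[symmetric])
  next
    case False
    then have k_new: "k \<notin> in_class E ` set pre" using Cons.prems(2) by simp
    have "\<And>l. (seen(k := Some a)) l = Some a \<longleftrightarrow> l \<in> in_class E ` set (pre @ [c])"
      using Cons.prems(2) by (auto simp: k_def)
    note * = Cons.IH[OF pre' this]
    define B where "B = build_list E a acc cs (seen(k := Some a))"
    note IH = *[folded B_def]
    have ok: "val (all_marked a acc (in_members E k)) \<longleftrightarrow> cls k \<subseteq> acceptable I a"
      by (auto simp: all_marked acc)
    have val: "fst (val (build_list E a acc (c # cs) seen)) =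
        (if cls k \<subseteq> acceptable I a then k # fst (val B) else fst (val B))"
      using False by (simp add: k_def[symmetric] split_beta B_def ok)
    have "steps (build_list E a acc (c # cs) seen) =
        Suc (steps (all_marked a acc (in_members E k)) + steps B)"
      using False by (simp add: k_def[symmetric] split_beta B_def)
    also have "\<dots> \<le> Suc (Suc (card (courses I)) + Suc (length cs * (2 + card (courses I))))"
      using all_marked(2)[of a acc "in_members E k"] length_members_le[OF k(1)] IH by simp
    finally have st: "steps (build_list E a acc (c # cs) seen) \<le>
        Suc (length (c # cs) * (2 + card (courses I)))"
      by simp
    have "supercourse_position I a (cls k) < supercourse_position I a (cls l)"
      if l: "l \<in> set (fst (val B))" and ck: "cls k \<subseteq> acceptable I a" for l
    proof -
      have l': "l \<notin> in_class E ` set (pre @ [c])" "cls l \<subseteq> acceptable I a" "l \<in> in_class E ` set cs"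
        using l IH by auto
      have "set cs \<subseteq> courses I"
        using pre' acceptable_subset[OF a] unfolding acceptable_def by (metis set_append Un_upper2 subset_trans)
      then have "l < r" using l'(3) in_class_less by blast
      then have la: "cls l \<in> allowed a" using l'(2) cls_supercourse by simp
      have "length pre < length (pref I a)" "pref I a ! length pre = c"
        using Cons.prems(1) by (simp_all add: nth_append flip: Cons.prems(1))
      then have "supercourse_position I a (cls k) \<le> length pre"
        using k(2) by (intro supercourse_position_le) auto
      \<comment> \<open>Otherwise the best course of \<open>l\<close> would be among those read up
        to \<open>c\<close>, and \<open>l\<close> would already be marked.\<close>
      moreover have "length pre < supercourse_position I a (cls l)"
      proof (rule ccontr)
        let ?i = "supercourse_position I a (cls l)"
        assume "\<not> length pre < ?i"
        then have i: "?i < length (pre @ [c])" by simp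
        then have "pref I a ! ?i = (pre @ [c]) ! ?i" unfolding pre'[symmetric] by (rule nth_append_left)
        then have "pref I a ! ?i \<in> set (pre @ [c])" using nth_mem[OF i] by (rule ssubst)
        moreover have "in_class E (pref I a ! ?i) = l"
          using pref_supercourse_position(2)[OF la] in_class[OF \<open>l < r\<close>] by blast
        ultimately show False using l'(1) by (metis imageI)
      qed
      ultimately show ?thesis by simp
    qed
    with IH have "sorted_wrt (<) (map (\<lambda>k. supercourse_position I a (cls k))
        (fst (val (build_list E a acc (c # cs) seen))))"
      unfolding val by (auto simp del: build_list.simps)
    moreover have "set (fst (val (build_list E a acc (c # cs) seen))) =
        {k \<in> in_class E ` set (c # cs) - in_class E ` set pre. cls k \<subseteq> acceptable I a}"
      using IH k_new unfolding val by (auto simp: k_def simp del: build_list.simps)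
    ultimately show ?thesis using st by blast
  qed
qed simp

text \<open>No mark of an applicant still to come is created, so \<open>build_lists\<close> need not
  clear the array.\<close>

lemma build_list_seen:
  "snd (val (build_list E a acc cs seen)) k = seen k \<or> snd (val (build_list E a acc cs seen)) k = Some a"
proof (induction cs arbitrary: seen)
  case (Cons c cs)
  show ?case
  proof (cases "seen (in_class E c) = Some a")
    case False
    with Cons[of "seen(in_class E c := Some a)"] show ?thesis
      by (auto simp: split_beta Let_def simp del: fun_upd_apply) (auto simp: split: if_splits)
  qed (use Cons in simp)
qed simp

definition pointers :: "('a \<Rightarrow> nat list) \<Rightarrow> ('a \<Rightarrow> 'c set list) \<Rightarrow> 'a \<Rightarrow> bool" where
  "pointers p rest a \<longleftrightarrow> set (p a) \<subseteq> {..<r} \<and> map cls (p a) = rest a"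

text \<open>Every allowed supercourse is nonempty, so it is met on the preference list; elements and
  increasing positions then determine the list.\<close>

lemma build_list_supercourse_list:
  assumes a: "a \<in> applicants I" and acc: "\<And>c. acc c = Some a \<longleftrightarrow> c \<in> acceptable I a"
    and seen: "\<And>k. seen k \<noteq> Some a"
  defines "ks \<equiv> fst (val (build_list E a acc (pref I a) seen))"
  shows "set ks \<subseteq> {..<r}" "map cls ks = supercourse_list I a"
proof -
  have *: "set ks = {k \<in> in_class E ` set (pref I a). cls k \<subseteq> acceptable I a}"
    "sorted_wrt (<) (map (\<lambda>k. supercourse_position I a (cls k)) ks)"
    using build_list[OF a acc, of "[]" "pref I a" seen] seen by (auto simp: ks_def)
  have courses: "set (pref I a) \<subseteq> courses I" using acceptable_subset[OF a] by (simp add: acceptable_def)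
  then show "set ks \<subseteq> {..<r}" using * in_class_less by auto
  have "cls ` set ks = allowed a"
  proof
    show "cls ` set ks \<subseteq> allowed a" using \<open>set ks \<subseteq> {..<r}\<close> cls_supercourse * by auto
    show "allowed a \<subseteq> cls ` set ks"
    proof
      fix X assume X: "X \<in> allowed a"
      then obtain k where k: "k < r" "X = cls k" using image_cls by blast
      obtain c where "c \<in> X" using X supercourse_nonempty by blast
      with X k have "c \<in> set (pref I a)" "in_class E c = k" using in_class by (auto simp: acceptable_def)
      then have "k \<in> in_class E ` set (pref I a)" by blast
      with X k * show "X \<in> cls ` set ks" by simp
    qed
  qed
  then show "map cls ks = supercourse_list I a"
    using * supercourse_list_eqI[of "map cls ks" a] by (simp add: comp_def)
qed

text \<open>Applicants still to be processed own no mark in either array. Per applicant there is one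
  step, then \<open>1 + length (pref I a)\<close> for marking and
  \<open>1 + length (pref I a) * (2 + card (courses I))\<close> for the list.\<close>

lemma build_lists:
  assumes "distinct as" "set as \<subseteq> applicants I"
    and "\<And>a c. a \<in> set as \<Longrightarrow> acc c \<noteq> Some a" "\<And>a k. a \<in> set as \<Longrightarrow> seen k \<noteq> Some a"
  shows "(\<forall>a. (if a \<in> set as then pointers (val (build_lists E as acc seen p)) (supercourse_list I) a
      else val (build_lists E as acc seen p) a = p a)) \<and>
    steps (build_lists E as acc seen p) \<le>
      Suc (\<Sum>a\<leftarrow>as. 3 + length (pref I a) * (3 + card (courses I)))"
  using assms
proof (induction as arbitrary: acc seen p)
  case (Cons a as)
  have a: "a \<in> applicants I" using Cons.prems by simp
  define acc' where "acc' = val (mark_acceptable a (in_pref E a) acc)"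
  define B where "B = build_list E a acc' (pref I a) seen"
  define R where "R = build_lists E as acc' (snd (val B)) (p(a := fst (val B)))"
  have acc': "acc' c = Some a \<longleftrightarrow> c \<in> acceptable I a" for c
    using Cons.prems(3)[of a c] by (simp add: acc'_def mark_acceptable in_pref[OF a] acceptable_def)
  have seen: "seen k \<noteq> Some a" for k using Cons.prems(4) by simp
  have R_def': "build_lists E (a # as) acc seen p = tick (bind_tm (mark_acceptable a (in_pref E a) acc)
      (\<lambda>acc'. bind_tm (build_list E a acc' (pref I a) seen)
        (\<lambda>(ks, seen'). build_lists E as acc' seen' (p(a := ks)))))"
    by (simp add: in_pref[OF a])
  have IH: "(\<forall>b. (if b \<in> set as then pointers (val R) (supercourse_list I) b
      else val R b = (p(a := fst (val B))) b)) \<and>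
    steps R \<le> Suc (\<Sum>a\<leftarrow>as. 3 + length (pref I a) * (3 + card (courses I)))"
    unfolding R_def
  proof (rule Cons.IH)
    show "distinct as" "set as \<subseteq> applicants I" using Cons.prems by auto
    show "acc' c \<noteq> Some b" if "b \<in> set as" for b c
      using that Cons.prems(1) Cons.prems(3)[of b c] by (auto simp: acc'_def mark_acceptable)
    show "snd (val B) k \<noteq> Some b" if "b \<in> set as" for b k
      using that Cons.prems(1) Cons.prems(4)[of b k] build_list_seen[of a acc' "pref I a" seen k]
      by (auto simp: B_def)
  qed
  have R: "val (build_lists E (a # as) acc seen p) = val R"
    "steps (build_lists E (a # as) acc seen p) =
      Suc (Suc (length (pref I a)) + (steps B + steps R))"
    unfolding R_def' by (simp_all add: R_def B_def acc'_def split_beta mark_acceptable(2) in_pref[OF a])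
  have "steps B \<le> Suc (length (pref I a) * (2 + card (courses I)))"
    unfolding B_def using build_list[OF a acc', of "[]" "pref I a" seen] seen by simp
  then have "steps (build_lists E (a # as) acc seen p) \<le>
      Suc (\<Sum>a\<leftarrow>a # as. 3 + length (pref I a) * (3 + card (courses I)))"
    using IH unfolding R(2) by (simp add: algebra_simps)
  moreover have "a \<notin> set as" using Cons.prems by simp
  then have "val R a = fst (val B)" using IH by (metis fun_upd_same)
  then have "pointers (val R) (supercourse_list I) a"
    using build_list_supercourse_list[of a acc' seen, OF a acc' seen] by (simp add: pointers_def B_def)
  ultimately show ?case using IH unfolding R(1) by (auto split: if_splits)
qed simp

subsection \<open>Refinement and running time\<close>

definition represents :: "('a, 'c) memory \<Rightarrow> ('a \<Rightarrow> 'c set list) \<Rightarrow> ('a \<Rightarrow> 'c set set) \<Rightarrow> bool" where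
  "represents m rest asg \<longleftrightarrow>
     (\<forall>a\<in>applicants I. pointers (ptr m) rest a \<and> asg a = cls ` {k. k < r \<and> has m (a, k)} \<and>
        load m a = (\<Sum>X\<in>asg a. card X)) \<and>
     (\<forall>c\<in>courses I. cnt m c = occupancy I asg c) \<and>
     (\<forall>k. vis m k \<le> stamp m) \<and> set (pairs m) = outcome asg"

lemma representsD:
  assumes "represents m rest asg"
  shows "a \<in> applicants I \<Longrightarrow> pointers (ptr m) rest a"
    and "a \<in> applicants I \<Longrightarrow> asg a = cls ` {k. k < r \<and> has m (a, k)}"
    and "a \<in> applicants I \<Longrightarrow> load m a = (\<Sum>X\<in>asg a. card X)"
    and "c \<in> courses I \<Longrightarrow> cnt m c = occupancy I asg c"
    and "vis m k \<le> stamp m" and "set (pairs m) = outcome asg"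
  using assms by (simp_all add: represents_def)

lemma has_iff:
  assumes "represents m rest asg" "a \<in> applicants I" "k < r"
  shows "has m (a, k) \<longleftrightarrow> cls k \<in> asg a"
  unfolding representsD(2)[OF assms(1,2)]
  using cls_in_image[OF assms(3), of "{k. k < r \<and> has m (a, k)}"] assms(3) by auto

text \<open>The supercourses in \<open>ls\<close> are new to \<open>a\<close> and pairwise disjoint,
  so load, counters and pairs grow exactly by their courses. The pointer of \<open>a\<close> may
  move at the same time.\<close>

lemma assign_all_represents:
  assumes a: "a \<in> applicants I" and rep: "represents m rest asg" and "valid asg"
    and ls: "distinct ls" "set ls \<subseteq> {..<r}" "cls ` set ls \<inter> asg a = {}"
    and "pointers p rest' a"
    and "\<And>b. b \<noteq> a \<Longrightarrow> p b = ptr m b \<and> rest' b = rest b"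
  shows "represents (val (assign_all E a ls (m\<lparr>ptr := p\<rparr>))) rest' (asg(a := asg a \<union> cls ` set ls))"
    (is "represents ?m rest' ?asg")
proof -
  let ?cs = "concat (map (in_members E) ls)"
  have asg: "asg a \<subseteq> supercourses I" using valid_allowed[OF \<open>valid asg\<close> a] by blast
  have S: "cls ` set ls \<subseteq> supercourses I" using ls(2) cls_supercourse by blast
  have set_cs: "set ?cs = \<Union>(cls ` set ls)" by simp
  have new: "\<Union>(asg a \<union> cls ` set ls) - \<Union>(asg a) = \<Union>(cls ` set ls)"
  proof -
    have "c \<notin> \<Union>(asg a)" if "l \<in> set ls" "c \<in> cls l" for c l
      using supercourse_in[OF asg, of "cls l" c] that S ls(3) by blast
    then show ?thesis by blast
  qed
  have "pointers (ptr ?m) rest' b \<and> ?asg b = cls ` {k. k < r \<and> has ?m (b, k)} \<and>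
      load ?m b = (\<Sum>X\<in>?asg b. card X)" if b: "b \<in> applicants I" for b
  proof (cases "b = a")
    case True
    have "{k. k < r \<and> has ?m (a, k)} = {k. k < r \<and> has m (a, k)} \<union> set ls"
      using ls(2) by (auto simp: assign_all(1))
    then have "?asg a = cls ` {k. k < r \<and> has ?m (a, k)}"
      using representsD(2)[OF rep a] by (simp add: image_Un)
    moreover have "(\<Sum>X\<in>asg a \<union> cls ` set ls. card X) = (\<Sum>X\<in>asg a. card X) + (\<Sum>X\<in>cls ` set ls. card X)"
      using ls(3) finite_assigned[OF valid_allowed[OF \<open>valid asg\<close> a]]
      by (intro sum.union_disjoint) auto
    then have "load ?m a = (\<Sum>X\<in>?asg a. card X)"
      using representsD(3)[OF rep a] sum_list_length_members[OF ls(1,2)] by (simp add: assign_all(1))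
    moreover have "pointers (ptr ?m) rest' a" using assms(7) by (simp add: assign_all(1) pointers_def)
    ultimately show ?thesis using True by simp
  next
    case False
    have "has ?m (b, k) = has m (b, k)" for k using False by (auto simp: assign_all(1))
    then show ?thesis
      using False representsD(1-3)[OF rep b] assms(8)[OF False]
      by (simp add: assign_all(1) pointers_def)
  qed
  moreover have "cnt ?m c = occupancy I ?asg c" if c: "c \<in> courses I" for c
  proof -
    have "count_list ?cs c = (if c \<in> \<Union>(cls ` set ls) then 1 else 0)"
      unfolding set_cs[symmetric] by (rule count_list_distinct[OF distinct_concat_members[OF ls(1,2)]])
    moreover have "occupancy I ?asg c = occupancy I asg c + (if c \<in> \<Union>(cls ` set ls) then 1 else 0)"
      using occupancy_update[OF a, of asg "asg a \<union> cls ` set ls" c] unfolding new by simp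
    moreover have "cnt ?m c = cnt m c + count_list ?cs c" by (simp add: assign_all(1))
    ultimately show ?thesis using representsD(4)[OF rep c] by simp
  qed
  moreover have "set (pairs ?m) = outcome ?asg"
  proof -
    have "set (pairs ?m) = Pair a ` \<Union>(cls ` set ls) \<union> outcome asg"
      using representsD(6)[OF rep] by (simp add: assign_all(1))
    also have "\<dots> = outcome ?asg"
    proof (rule set_eqI)
      fix p
      show "p \<in> Pair a ` \<Union>(cls ` set ls) \<union> outcome asg \<longleftrightarrow> p \<in> outcome ?asg"
        using a by (cases p; cases "fst p = a") (auto simp: outcome_def)
    qed
    finally show ?thesis .
  qed
  moreover have "\<forall>k. vis ?m k \<le> stamp ?m" using representsD(5)[OF rep] by (simp add: assign_all(1))
  ultimately show ?thesis unfolding represents_def by blast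
qed

text \<open>Bound for the work on one list entry: its own step, \<open>room_in\<close>,
  \<open>search\<close>, \<open>unassigned\<close>, \<open>room_in_all\<close>,
  \<open>count_all_courses\<close> and \<open>assign_all\<close> added up.\<close>

definition item_steps :: "'a \<Rightarrow> nat" where
  "item_steps a = 8 + 12 * card (courses I) + 2 * card (immediate_prereq I a)"

text \<open>An amortised bound with potential \<open>item_steps a\<close> for each entry left: every
  examined entry is paid for by the potential it releases. The additive 1 is the step on the empty
  list.\<close>

lemma turn_tm:
  assumes a: "a \<in> applicants I" and "valid asg"
    and "set ks \<subseteq> {..<r}" "represents m rest asg"
  shows "represents (val (turn_tm E a ks m)) (rest(a := fst (turn I a (map cls ks) asg)))
      (snd (turn I a (map cls ks) asg)) \<and>
    steps (turn_tm E a ks m) + item_steps a * length (fst (turn I a (map cls ks) asg))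
      \<le> 1 + item_steps a * length ks"
  using assms(3,4)
proof (induction ks arbitrary: m)
  case Nil
  then show ?case by (auto simp: represents_def pointers_def)
next
  case (Cons k ks)
  note rep = Cons.prems(2)
  have k: "k < r" and ks: "set ks \<subseteq> {..<r}" using Cons.prems by auto
  have X: "cls k \<in> supercourses I" by (rule cls_supercourse[OF k])
  have asg: "asg a \<subseteq> supercourses I" using valid_allowed[OF \<open>valid asg\<close> a] by blast
  define T where "T = turn I a (map cls ks) asg"
  \<comment> \<open>Stated for every memory representing the current state, as a search alters marks
    and stamp even if \<open>k\<close> is then refused.\<close>
  have skip: "represents (val (turn_tm E a ks m')) (rest(a := fst T)) (snd T) \<and>
      steps (turn_tm E a ks m') + item_steps a * length (fst T) \<le> 1 + item_steps a * length ks"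
    if "represents m' rest asg" for m'
    unfolding T_def by (rule Cons.IH[OF ks that])
  have room: "cnt m c < in_ccap E c \<longleftrightarrow> undersubscribed I asg c" if "c \<in> courses I" for c
    using that representsD(4)[OF rep] in_ccap by (simp add: undersubscribed_def)
  define rs where "rs = room_in E (cnt m) (in_members E k)"
  have rs_val: "val rs \<longleftrightarrow> (\<forall>c\<in>cls k. undersubscribed I asg c)"
    using room supercourse_subset[OF X] by (auto simp: rs_def room_in(1))
  have rs_steps: "steps rs \<le> Suc (card (courses I))"
    using room_in(2)[of E "cnt m" "in_members E k"] length_members_le[OF k] by (simp add: rs_def)
  have skip_turn: "turn I a (map cls (k # ks)) asg = T" if "\<not> can_take I a (cls k) asg"
    using that by (simp add: turn_Cons T_def)
  have item: "item_steps a * length (k # ks) = item_steps a + item_steps a * length ks" by simp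
  have item_pos: "1 \<le> item_steps a" by (simp add: item_steps_def)
  consider (assigned) "has m (a, k)" | (no_room) "\<not> has m (a, k)" "\<not> val rs"
    | (search) "\<not> has m (a, k)" "val rs" by blast
  then show ?case
  proof cases
    case assigned
    then have "\<not> can_take I a (cls k) asg"
      using has_iff[OF rep a k] by (simp add: can_take_def Let_def)
    moreover have "turn_tm E a (k # ks) m = tick (turn_tm E a ks m)" using assigned by simp
    ultimately show ?thesis
      using skip[OF rep] skip_turn item item_pos
      by (simp del: turn_tm.simps list.map fun_upd_apply list.size)
  next
    case no_room
    then have "\<not> can_take I a (cls k) asg" using rs_val by (auto simp: can_take_def Let_def)
    moreover have "val (turn_tm E a (k # ks) m) = val (turn_tm E a ks m)"
      "steps (turn_tm E a (k # ks) m) = Suc (steps rs + steps (turn_tm E a ks m))"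
      using no_room by (simp_all add: rs_def)
    moreover have "Suc (steps rs) \<le> item_steps a" using rs_steps by (simp add: item_steps_def)
    ultimately show ?thesis using skip[OF rep] skip_turn item
      by (simp del: turn_tm.simps list.map fun_upd_apply list.size)
  next
    case search
    define st where "st = Suc (stamp m)"
    define sr where "sr = search r (in_imm E a) st [k] (vis m) []"
    define m' where "m' = m\<lparr>vis := snd (val sr), stamp := st\<rparr>"
    define us where "us = unassigned (has m') a (fst (val sr))"
    define oa where "oa = room_in_all E (cnt m') (val us)"
    define ca where "ca = count_all_courses E (val us) 0"
    define final where "final = (if val oa \<and> load m' a + val ca \<le> in_acap E a
        then assign_all E a (val us) (m'\<lparr>ptr := (ptr m')(a := ks)\<rparr>) else turn_tm E a ks m')"
    have tt: "val (turn_tm E a (k # ks) m) = val final"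
      "steps (turn_tm E a (k # ks) m) =
        Suc (steps rs + steps sr + steps us + steps oa + steps ca + steps final)"
      using search
      by (simp_all add: rs_def sr_def st_def m'_def us_def oa_def ca_def final_def split_beta Let_def
          del: search.simps)
    have "vis m l < st" for l using representsD(5)[OF rep, of l] by (simp add: st_def less_Suc_eq_le)
    note ds = with_prereqs_search[of a k "vis m" st, OF a k this, folded sr_def]
    have rep': "represents m' rest asg"
      unfolding represents_def
    proof (intro conjI)
      show "\<forall>l. vis m' l \<le> stamp m'"
      proof
        fix l
        show "vis m' l \<le> stamp m'"
          using search_vis[of r "in_imm E a" st "[k]" "vis m" "[]" l] representsD(5)[OF rep, of l]
          by (auto simp: m'_def sr_def st_def)
      qed
    qed (use representsD[OF rep] in \<open>simp_all add: m'_def\<close>)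
    let ?D = "with_prereqs I a (cls k)"
    have us_val: "val us = filter (\<lambda>l. \<not> has m' (a, l)) (fst (val sr))"
      by (simp add: us_def unassigned(1))
    then have us: "distinct (val us)" "set (val us) \<subseteq> {..<r}" using ds(1,2) by auto
    have us_cls: "cls ` set (val us) = ?D - asg a"
      using ds(2) has_iff[OF rep' a] unfolding us_val ds(3)[symmetric] by auto
    have D: "?D \<subseteq> supercourses I" by (rule with_prereqs_subset_supercourses[OF a X])
    have "val oa \<longleftrightarrow> (\<forall>c\<in>\<Union>(?D - asg a). cnt m c < in_ccap E c)"
      unfolding us_cls[symmetric] by (simp add: oa_def room_in_all(1) m'_def)
    \<comment> \<open>The machine tests for being undersubscribed, which in a valid assignment is
      the same as not being full.\<close>
    also have "\<dots> \<longleftrightarrow> (\<forall>c\<in>\<Union>(?D - asg a). \<not> full I asg c)"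
      using D supercourse_subset room undersubscribed_iff[OF \<open>valid asg\<close>]
      by (intro ball_cong refl) blast
    finally have oa_val: "val oa \<longleftrightarrow> (\<forall>c\<in>\<Union>(?D - asg a). \<not> full I asg c)" .
    have ca_val: "val ca = (\<Sum>Y\<in>?D - asg a. card Y)"
      using sum_list_length_members[OF us] by (simp add: ca_def count_all_courses(1) us_cls)
    have take: "val oa \<and> load m' a + val ca \<le> in_acap E a \<longleftrightarrow> can_take I a (cls k) asg"
      unfolding oa_val ca_val representsD(3)[OF rep' a] in_acap[OF a] can_take_def Let_def
      using search rs_val has_iff[OF rep a k] by blast
    have "steps sr \<le> 2 + card (courses I) + 2 * card (immediate_prereq I a)"
      unfolding sr_def by (rule search_steps_le[OF a])
    moreover have "steps us \<le> Suc (card (courses I))"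
      using length_le_courses[OF ds(1,2)] by (simp add: us_def unassigned(2))
    moreover have "steps oa \<le> 1 + 3 * card (courses I)"
      using room_in_all(2)[of E "cnt m'" "val us"] members_steps_le[OF us] by (simp add: oa_def)
    moreover have "steps ca \<le> 1 + 3 * card (courses I)"
      using members_steps_le[OF us] by (simp add: ca_def count_all_courses(2))
    \<comment> \<open>This leaves \<open>1 + 3 * card (courses I)\<close> of
      \<open>item_steps a\<close>, the price of \<open>assign_all\<close>.\<close>
    ultimately have before: "Suc (steps rs + steps sr + steps us + steps oa + steps ca) \<le>
        7 + 9 * card (courses I) + 2 * card (immediate_prereq I a)"
      using rs_steps by linarith
    then have before': "Suc (steps rs + steps sr + steps us + steps oa + steps ca) \<le> item_steps a"
      by (simp add: item_steps_def)
    show ?thesis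
    proof (cases "can_take I a (cls k) asg")
      case True
      then have final_eq: "final = assign_all E a (val us) (m'\<lparr>ptr := (ptr m')(a := ks)\<rparr>)"
        unfolding take[symmetric] final_def by (rule if_P)
      have "represents (val final) (rest(a := map cls ks)) (asg(a := asg a \<union> cls ` set (val us)))"
        unfolding final_eq
        by (rule assign_all_represents[OF a rep' \<open>valid asg\<close> us]) (use us_cls ks in \<open>auto simp: pointers_def\<close>)
      moreover have "asg a \<union> cls ` set (val us) = asg a \<union> ?D" unfolding us_cls by blast
      moreover have "steps final \<le> 1 + 3 * card (courses I)"
        using members_steps_le[OF us] by (simp add: final_eq assign_all(2))
      ultimately show ?thesis
        unfolding tt item using before True
        by (simp add: turn_Cons item_steps_def del: fun_upd_apply)
    next
      case False
      then have "final = turn_tm E a ks m'"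
        unfolding take[symmetric] final_def by (rule if_not_P)
      then show ?thesis
        unfolding tt item skip_turn[OF False] using before' skip[OF rep']
        by (simp del: fun_upd_apply)
    qed
  qed
qed

text \<open>The potentials of all applicants pay for the list entries; beyond that, each turn costs
  one step of the loop and the additive 1 of \<open>turn_tm\<close>.\<close>

lemma process_tm:
  assumes "set \<sigma> \<subseteq> applicants I" "valid asg" "represents m rest asg"
    and "\<And>a. a \<in> applicants I \<Longrightarrow> set (rest a) \<subseteq> allowed a"
  shows "set (pairs (val (process_tm E \<sigma> m))) = outcome (process I \<sigma> rest asg) \<and>
    steps (process_tm E \<sigma> m) \<le>
      1 + 2 * length \<sigma> + (\<Sum>a\<in>applicants I. item_steps a * length (rest a))"
  using assms
proof (induction \<sigma> arbitrary: m rest asg)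
  case Nil
  then show ?case using representsD(6) by simp
next
  case (Cons a \<sigma>)
  have a: "a \<in> applicants I" using Cons.prems by simp
  define T where "T = turn I a (rest a) asg"
  have ptr: "set (ptr m a) \<subseteq> {..<r}" "map cls (ptr m a) = rest a"
    using representsD(1)[OF Cons.prems(3) a] by (simp_all add: pointers_def)
  have len: "length (ptr m a) = length (rest a)" using arg_cong[OF ptr(2), of length] by simp
  define m' where "m' = val (turn_tm E a (ptr m a) m)"
  have m': "represents m' (rest(a := fst T)) (snd T)"
    and steps: "steps (turn_tm E a (ptr m a) m) + item_steps a * length (fst T)
      \<le> 1 + item_steps a * length (rest a)"
    using turn_tm[OF a Cons.prems(2) ptr(1) Cons.prems(3)]
    unfolding m'_def T_def ptr(2) len by simp_all
  have T: "valid (snd T)" "set (fst T) \<subseteq> set (rest a)"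
    using turn_valid[OF a Cons.prems(4)[OF a] Cons.prems(2)] by (simp_all add: T_def)
  have IH: "set (pairs (val (process_tm E \<sigma> m'))) = outcome (process I \<sigma> (rest(a := fst T)) (snd T)) \<and>
    steps (process_tm E \<sigma> m') \<le>
      1 + 2 * length \<sigma> + (\<Sum>b\<in>applicants I. item_steps b * length ((rest(a := fst T)) b))"
  proof (rule Cons.IH)
    show "set \<sigma> \<subseteq> applicants I" using Cons.prems(1) by simp
    show "set ((rest(a := fst T)) b) \<subseteq> allowed b" if "b \<in> applicants I" for b
      using Cons.prems(4)[OF that] T(2) by (cases "b = a") auto
  qed (rule T(1) m')+
  have "(\<Sum>b\<in>applicants I. item_steps b * length ((rest(a := fst T)) b)) + item_steps a * length (rest a) =
    (\<Sum>b\<in>applicants I. item_steps b * length (rest b)) + item_steps a * length (fst T)"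
    unfolding sum.remove[OF finite_applicants a] by simp
  moreover have "steps (process_tm E (a # \<sigma>) m) =
      Suc (steps (turn_tm E a (ptr m a) m) + steps (process_tm E \<sigma> m'))"
    by (simp add: m'_def)
  ultimately have "steps (process_tm E (a # \<sigma>) m) \<le>
      1 + 2 * length (a # \<sigma>) + (\<Sum>a\<in>applicants I. item_steps a * length (rest a))"
    using IH steps by simp
  moreover have "val (process_tm E (a # \<sigma>) m) = val (process_tm E \<sigma> m')" by (simp add: m'_def)
  ultimately show ?case using IH unfolding process_Cons T_def[symmetric] by simp
qed

section \<open>Summing up the running time\<close>

text \<open>The second bound holds because positions map injectively to indices of the preference
  list. In \<open>item_steps_le\<close>, the first bound serves the prerequisite term and the second
  the other terms.\<close>

lemma length_supercourse_list:
  shows "length (supercourse_list I a) \<le> card (courses I)"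
    and "length (supercourse_list I a) \<le> length (pref I a)"
proof -
  have card: "length (supercourse_list I a) = card (allowed a)"
    using distinct_card[OF distinct_supercourse_list[of a]] by (simp add: set_supercourse_list)
  then show "length (supercourse_list I a) \<le> card (courses I)"
    using card_le_courses[of "allowed a"] by auto
  have "card (allowed a) \<le> card {..<length (pref I a)}"
    using pref_supercourse_position(1)
    by (intro card_inj_on_le[OF inj_on_supercourse_position]) auto
  with card show "length (supercourse_list I a) \<le> length (pref I a)" by simp
qed

text \<open>A nonempty preference list forces the existence of a course, so linear terms can be
  absorbed into the product.\<close>

lemma pref_nonempty_courses:
  assumes "a \<in> applicants I"
  shows "length (pref I a) \<le> card (courses I) * length (pref I a)"
proof (cases "pref I a")
  case (Cons c cs)
  then have "c \<in> courses I" using acceptable_subset[OF assms] by (auto simp: acceptable_def)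
  then have "1 \<le> card (courses I)" using finite_courses by (metis card_gt_0_iff empty_iff One_nat_def Suc_leI)
  then show ?thesis by simp
qed simp

text \<open>The coefficient 20 adds the 8 and the 12 of \<open>item_steps\<close>, the constant term
  being absorbed by \<open>pref_nonempty_courses\<close>.\<close>

lemma item_steps_le:
  assumes "a \<in> applicants I"
  shows "item_steps a * length (supercourse_list I a) \<le>
    card (courses I) * (20 * length (pref I a) + 2 * card (immediate_prereq I a))"
proof -
  let ?n = "card (courses I)" and ?l = "length (supercourse_list I a)"
  have "item_steps a * ?l = 8 * ?l + 12 * (?n * ?l) + 2 * (?l * card (immediate_prereq I a))"
    by (simp add: item_steps_def algebra_simps)
  moreover have "?l \<le> ?n * length (pref I a)"
    using length_supercourse_list(2)[of a] pref_nonempty_courses[OF assms] by linarith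
  moreover have "?n * ?l \<le> ?n * length (pref I a)"
    using length_supercourse_list(2) by (rule mult_le_mono2)
  moreover have "?l * card (immediate_prereq I a) \<le> ?n * card (immediate_prereq I a)"
    using length_supercourse_list(1) by (rule mult_le_mono1)
  moreover have "?n * (20 * length (pref I a) + 2 * card (immediate_prereq I a)) =
      20 * (?n * length (pref I a)) + 2 * (?n * card (immediate_prereq I a))"
    by (simp add: algebra_simps)
  ultimately show ?thesis by linarith
qed

theorem sm_cacpr_tm:
  assumes "policy I \<sigma>"
  shows "set (val (sm_cacpr_tm E \<sigma>)) = sm_cacpr I \<sigma>"
    and "steps (sm_cacpr_tm E \<sigma>) \<le> 24 * (1 + total_capacity I +
      card (courses I) * (total_pref_length I + total_immediate_prereqs I))"
proof -
  let ?n = "card (courses I)"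
  define B where "B = build_lists E (in_applicants E) (\<lambda>_. None) (\<lambda>_. None) (\<lambda>_. [])"
  define m :: "('a, 'c) memory" where
    "m = \<lparr>ptr = val B, has = \<lambda>_. False, load = \<lambda>_. 0, cnt = \<lambda>_. 0, vis = \<lambda>_. 0, stamp = 0, pairs = []\<rparr>"
  define P where "P = process_tm E \<sigma> m"
  have sm: "val (sm_cacpr_tm E \<sigma>) = pairs (val P)"
    "steps (sm_cacpr_tm E \<sigma>) = Suc (steps B + steps P)"
    by (simp_all add: sm_cacpr_tm_def B_def m_def P_def)
  have \<sigma>: "set \<sigma> \<subseteq> applicants I" "\<And>a. a \<in> applicants I \<Longrightarrow> count_list \<sigma> a \<le> acap I a"
    using assms by (simp_all add: policy_def)
  have B: "(\<forall>a\<in>applicants I. pointers (val B) (supercourse_list I) a) \<and>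
      steps B \<le> Suc (\<Sum>a\<leftarrow>in_applicants E. 3 + length (pref I a) * (3 + ?n))"
    using build_lists[of "in_applicants E" "\<lambda>_. None" "\<lambda>_. None" "\<lambda>_. []"] in_applicants
    by (auto simp: B_def split: if_splits)
  have "represents m (supercourse_list I) (\<lambda>_. {})"
    using B by (simp add: represents_def m_def occupancy_def outcome_def pointers_def)
  note P = process_tm[OF \<sigma>(1) valid_empty this, folded P_def]
  show "set (val (sm_cacpr_tm E \<sigma>)) = sm_cacpr I \<sigma>"
    using P by (simp add: sm sm_cacpr_outcome set_supercourse_list)
  \<comment> \<open>Positive capacities let the constant overhead of each applicant be charged to
    the total capacity.\<close>
  have cap: "card (applicants I) \<le> total_capacity I"
    unfolding total_capacity_def card_eq_sum by (intro sum_mono) (simp add: Suc_leI acap_pos)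
  have len: "length \<sigma> \<le> total_capacity I"
    unfolding total_capacity_def sum_count_list[OF finite_applicants \<sigma>(1), symmetric]
    by (intro sum_mono \<sigma>(2))
  have "(\<Sum>a\<leftarrow>in_applicants E. 3 + length (pref I a) * (3 + ?n)) =
      (\<Sum>a\<in>applicants I. 3 + length (pref I a) * (3 + ?n))"
    using in_applicants by (simp add: sum_list_distinct_conv_sum_set)
  also have "\<dots> \<le> (\<Sum>a\<in>applicants I. 3 + 4 * (?n * length (pref I a)))"
  proof (rule sum_mono)
    fix a assume "a \<in> applicants I"
    from pref_nonempty_courses[OF this]
    show "3 + length (pref I a) * (3 + ?n) \<le> 3 + 4 * (?n * length (pref I a))"
      by (simp add: algebra_simps)
  qed
  also have "\<dots> = 3 * card (applicants I) + 4 * (?n * total_pref_length I)"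
    by (simp add: sum.distrib total_pref_length_def sum_distrib_left)
  finally have B': "steps B \<le> 1 + 3 * total_capacity I + 4 * (?n * total_pref_length I)"
    using B cap by linarith
  have "(\<Sum>a\<in>applicants I. item_steps a * length (supercourse_list I a)) \<le>
      (\<Sum>a\<in>applicants I. ?n * (20 * length (pref I a) + 2 * card (immediate_prereq I a)))"
    by (intro sum_mono item_steps_le)
  also have "\<dots> = 20 * (?n * total_pref_length I) + 2 * (?n * total_immediate_prereqs I)"
    by (simp add: sum.distrib total_pref_length_def total_immediate_prereqs_def sum_distrib_left
        algebra_simps)
  finally have P': "steps P \<le> 1 + 2 * total_capacity I + 20 * (?n * total_pref_length I) +
      2 * (?n * total_immediate_prereqs I)"
    using P len by (simp add: set_supercourse_list)
  \<comment> \<open>The largest coefficient is that of \<open>?n * total_pref_length I\<close>: 4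
    from building the lists and 20 from the run.\<close>
  show "steps (sm_cacpr_tm E \<sigma>) \<le> 24 * (1 + total_capacity I +
      ?n * (total_pref_length I + total_immediate_prereqs I))"
    unfolding sm using B' P' by (simp add: algebra_simps)
qed

end

text \<open>The constant 24 serves all instances, encodings and policies. The additive 1 in the
  bound covers instances without applicants, where a few steps are still taken.\<close>

theorem theorem11:
  shows "(\<forall>(I :: ('a, 'c) cacpr) \<sigma>. cacpr_instance I \<and> policy I \<sigma> \<longrightarrow>
            matching I (sm_cacpr I \<sigma>) \<and>
            (complete_policy I \<sigma> \<longrightarrow> pareto_optimal I (sm_cacpr I \<sigma>))) \<and>
         (\<exists>K. \<forall>(I :: ('a, 'c) cacpr) E \<sigma>.
            cacpr_instance I \<and> encodes E I \<and> policy I \<sigma> \<longrightarrow>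
              set (val (sm_cacpr_tm E \<sigma>)) = sm_cacpr I \<sigma> \<and>
              steps (sm_cacpr_tm E \<sigma>)
                \<le> K * (1 + total_capacity I +
                       card (courses I) * (total_pref_length I + total_immediate_prereqs I)))"
proof (rule conjI)
  show "\<forall>(I :: ('a, 'c) cacpr) \<sigma>. cacpr_instance I \<and> policy I \<sigma> \<longrightarrow>
      matching I (sm_cacpr I \<sigma>) \<and> (complete_policy I \<sigma> \<longrightarrow> pareto_optimal I (sm_cacpr I \<sigma>))"
    by (simp add: course_allocation.intro course_allocation.matching_sm_cacpr
        course_allocation.pareto_optimal_sm_cacpr)
  show "\<exists>K. \<forall>(I :: ('a, 'c) cacpr) E \<sigma>. cacpr_instance I \<and> encodes E I \<and> policy I \<sigma> \<longrightarrow>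
      set (val (sm_cacpr_tm E \<sigma>)) = sm_cacpr I \<sigma> \<and>
      steps (sm_cacpr_tm E \<sigma>) \<le> K * (1 + total_capacity I +
        card (courses I) * (total_pref_length I + total_immediate_prereqs I))"
  proof (intro exI allI impI)
    fix I :: "('a, 'c) cacpr" and E \<sigma>
    assume *: "cacpr_instance I \<and> encodes E I \<and> policy I \<sigma>"
    then interpret encoded_course_allocation I E by unfold_locales auto
    show "set (val (sm_cacpr_tm E \<sigma>)) = sm_cacpr I \<sigma> \<and>
      steps (sm_cacpr_tm E \<sigma>) \<le> 24 * (1 + total_capacity I +
        card (courses I) * (total_pref_length I + total_immediate_prereqs I))"
      using sm_cacpr_tm * by blast
  qed
qed

end
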